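(* Suppose $Z_1\overset{d}{=}\mathcal N(0,1)$, i.e. the data are $n$ i.i.d. samples from $\mathcal N(0,\Sigma)$ on $\mathbb R^{p+q}$, and $\sqrt{pq}/n\le M$ for some $M>1$. Let $\Sigma_0=\mathrm{diag}(\Sigma_X,\Sigma_Y)$. Then for any small $\delta\in(0,1)$ there exists some positive constant $\zeta=\zeta(\delta,M)$ such that $$\inf_{\psi}\ \sup_{\Sigma\in\Theta(\zeta,\Sigma_0;M)}\Big(\mathbb E_{\Sigma_0}\psi(\mathbf X,\mathbf Y)+\mathbb E_{\Sigma}\big(1-\psi(\mathbf X,\mathbf Y)\big)\Big)\ge1-\delta,$$ where the infimum is taken over all measurable test functions $\psi$.
   Context: For $\zeta>0$, $M>1$ and $\Sigma_0=\mathrm{diag}(\Sigma_X,\Sigma_Y)$ (with $\Sigma_X\in\mathbb R^{p\times p}$ and $\Sigma_Y\in\mathbb R^{q\times q}$ covariance matrices), the alternative class is $$\Theta(\zeta,\Sigma_0;M)=\Big\{\Sigma=\begin{pmatrix}\Sigma_X&\Sigma_{XY}\\ \Sigma_{YX}&\Sigma_Y\end{pmatrix}\in\mathbb R^{(p+q)\times(p+q)}:\ \|\Sigma_{XY}\|_F^2\ge\zeta\sqrt{pq}/n,\ M^{-1}\le\lambda_{\min}(\Sigma)\le\lambda_{\max}(\Sigma)\le M\Big\},$$ consisting of covariance matrices whose diagonal blocks are the blocks $\Sigma_X,\Sigma_Y$ of $\Sigma_0$; $\|\cdot\|_F$ is the Frobenius norm and $\lambda_{\min},\lambda_{\max}$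 are the smallest and largest eigenvalues. In the general model the data vector is $(X^\top,Y^\top)^\top\overset{d}{=}\Sigma^{1/2}Z$ with $Z\in\mathbb R^{p+q}$ having i.i.d. components distributed as $Z_1$; here $Z_1$ is standard normal. $\mathbb E_\Sigma$ denotes expectation when $(\mathbf X,\mathbf Y)=((X_1,Y_1),\dots,(X_n,Y_n))$ are i.i.d. with $(X_i^\top,Y_i^\top)^\top\sim\mathcal N(0,\Sigma)$, $X_i\in\mathbb R^p$, $Y_i\in\mathbb R^q$.
   Formalization: The eigenvalues of Σ_0 are additionally assumed to lie in [1/M_0, M_0] for some 1 ≤ M_0 < M, and ζ may depend on M_0 as well as δ and M; without this the claim fails, e.g. for Σ_0 = M·I, where the alternative class is empty. *)

theory Defs
  imports
    "HOL-Analysis.Analysis"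
    "Jordan_Normal_Form.Char_Poly"
    "Jordan_Normal_Form.Gauss_Jordan_Elimination"
begin

text \<open>
  The dimensions \<open>p\<close>, \<open>q\<close> and the sample size \<open>n\<close> are natural numbers rather than types, because the
  constant \<open>\<zeta>\<close> of the theorem has to be chosen before them.  Matrices are those of
  \<open>Jordan_Normal_Form\<close>; a point of \<open>d\<close>-dimensional space is an element of the product space of
  \<open>d\<close> copies of the real line, indexed by \<open>{..<d}\<close>.
\<close>

definition covariance_mat :: "nat \<Rightarrow> real mat \<Rightarrow> bool" where
  "covariance_mat d A \<longleftrightarrow>
     A \<in> carrier_mat d d \<and> transpose_mat A = A \<and> (\<forall>v \<in> carrier_vec d. v \<bullet> (A *\<^sub>v v) \<ge> 0)"

text \<open>Meant for symmetric matrices of positive dimension, whose set of real eigenvalues is finite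
  and nonempty.\<close>

definition lambda_min :: "real mat \<Rightarrow> real" where
  "lambda_min A = Min {k. eigenvalue A k}"

definition lambda_max :: "real mat \<Rightarrow> real" where
  "lambda_max A = Max {k. eigenvalue A k}"

definition frobenius_norm :: "real mat \<Rightarrow> real" where
  "frobenius_norm A = sqrt (\<Sum>i<dim_row A. \<Sum>j<dim_col A. (A $$ (i, j))\<^sup>2)"

definition block_diag :: "real mat \<Rightarrow> real mat \<Rightarrow> real mat" where
  "block_diag A B = four_block_mat A (0\<^sub>m (dim_row A) (dim_col B)) (0\<^sub>m (dim_row B) (dim_col A)) B"

text \<open>The alternative class for \<open>\<Sigma>\<^sub>0 = block_diag SX SY\<close>.  It is empty if
  some eigenvalue of \<open>\<Sigma>\<^sub>0\<close> lies outside \<open>[1/M, M]\<close>, and also for \<open>\<Sigma>\<^sub>0 = M I\<close> and \<open>\<zeta> > 0\<close>;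
  a lower bound that is uniform in \<open>\<Sigma>\<^sub>0\<close> needs the spectrum of \<open>\<Sigma>\<^sub>0\<close> to stay away from
  \<open>1/M\<close> and \<open>M\<close>.\<close>

definition Theta :: "nat \<Rightarrow> nat \<Rightarrow> nat \<Rightarrow> real \<Rightarrow> real mat \<Rightarrow> real mat \<Rightarrow> real \<Rightarrow> real mat set" where
  "Theta p q n \<zeta> SX SY M =
     {four_block_mat SX SXY (transpose_mat SXY) SY | SXY.
        SXY \<in> carrier_mat p q \<and>
        covariance_mat (p + q) (four_block_mat SX SXY (transpose_mat SXY) SY) \<and>
        (frobenius_norm SXY)\<^sup>2 \<ge> \<zeta> * sqrt (real p * real q) / real n \<and>
        1 / M \<le> lambda_min (four_block_mat SX SXY (transpose_mat SXY) SY) \<and>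
        lambda_max (four_block_mat SX SXY (transpose_mat SXY) SY) \<le> M}"

text \<open>The nondegenerate centred normal law: meaningful for positive definite \<open>S\<close>, the only case
  that occurs here.\<close>

definition mvn_density :: "nat \<Rightarrow> real mat \<Rightarrow> (nat \<Rightarrow> real) \<Rightarrow> real" where
  "mvn_density d S x =
     exp (- (vec d x \<bullet> (the (mat_inverse S) *\<^sub>v vec d x)) / 2) / sqrt ((2 * pi) ^ d * det S)"

definition mvn :: "nat \<Rightarrow> real mat \<Rightarrow> (nat \<Rightarrow> real) measure" where
  "mvn d S = density (PiM {..<d} (\<lambda>_. lborel)) (\<lambda>x. ennreal (mvn_density d S x))"

text \<open>
  A sample \<open>\<omega>\<close> consists of the \<open>n\<close> stacked observations: \<open>\<omega> i j\<close> is the \<open>j\<close>-th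
  coordinate of \<open>X\<^sub>i\<close> for \<open>j < p\<close>, and \<open>\<omega> i (p + j)\<close> is the \<open>j\<close>-th coordinate of \<open>Y\<^sub>i\<close>
  for \<open>j < q\<close>.
\<close>

definition sample_law :: "nat \<Rightarrow> nat \<Rightarrow> real mat \<Rightarrow> (nat \<Rightarrow> nat \<Rightarrow> real) measure" where
  "sample_law n d S = PiM {..<n} (\<lambda>_. mvn d S)"

text \<open>Tests may be randomised: \<open>\<psi> \<omega>\<close> is the probability of rejecting.\<close>

definition tests :: "nat \<Rightarrow> nat \<Rightarrow> ((nat \<Rightarrow> nat \<Rightarrow> real) \<Rightarrow> real) set" where
  "tests n d = {\<psi> \<in> borel_measurable (PiM {..<n} (\<lambda>_. PiM {..<d} (\<lambda>_. borel))).
                  \<forall>\<omega> \<in> space (PiM {..<n} (\<lambda>_. PiM {..<d} (\<lambda>_. borel))). 0 \<le> \<psi> \<omega> \<and> \<psi> \<omega> \<le> 1}"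

text \<open>Sum of the type I error at \<open>S0\<close> and the type II error at \<open>S\<close>.\<close>

definition testing_risk ::
  "nat \<Rightarrow> nat \<Rightarrow> real mat \<Rightarrow> real mat \<Rightarrow> ((nat \<Rightarrow> nat \<Rightarrow> real) \<Rightarrow> real) \<Rightarrow> real" where
  "testing_risk n d S0 S \<psi> =
     (\<integral>\<omega>. \<psi> \<omega> \<partial>sample_law n d S0) + (\<integral>\<omega>. (1 - \<psi> \<omega>) \<partial>sample_law n d S)"

end

theory Submission
  imports Defs "HOL-Probability.Distributions"
begin

text \<open>
  The bound is proved by Le Cam's method with a finite mixture of alternatives.  Let \<open>r\<^sup>2 = \<zeta> \<surd>(pq) / n\<close>
  and let \<open>a\<close> run over the vectors with entries \<open>\<plusminus>1/\<surd>p\<close> on the first \<open>p\<close> coordinates, \<open>b\<close> over those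
  with entries \<open>\<plusminus>1/\<surd>q\<close> on the last \<open>q\<close>.  The alternatives are the matrices
  \<open>\<Sigma>\<^sub>0 + r (a b\<^sup>T + b a\<^sup>T)\<close>.  Their off-diagonal block is \<open>r a b\<^sup>T\<close>, whose squared Frobenius norm is
  exactly \<open>r\<^sup>2\<close>; and since \<open>\<surd>(pq) / n \<le> M\<close>, a small \<open>\<zeta>\<close> makes \<open>r\<close> small, so that the spectrum stays
  in \<open>[1/M, M]\<close> because that of \<open>\<Sigma>\<^sub>0\<close> lies in the smaller interval \<open>[1/M0, M0]\<close>.

  If the chi-square divergence of the average of the alternative laws from the null law is at most
  \<open>\<delta>\<^sup>2\<close>, then every test has average risk at least \<open>1 - \<delta>\<close>, hence risk at least \<open>1 - \<delta>\<close> at one of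
  the alternatives (\<open>second_moment_testing_bound\<close>).  Expanding the square, this divergence is an
  average, over two independent choices \<open>(a, b)\<close> and \<open>(a', b')\<close>, of \<open>\<integral> f\<^sub>1 f\<^sub>2 / f\<^sub>0\<close> to the power \<open>n\<close>.  With
  \<open>\<alpha> = a \<bullet> \<Sigma>\<^sub>0\<^sup>-\<^sup>1 a'\<close> and \<open>\<beta> = b \<bullet> \<Sigma>\<^sub>0\<^sup>-\<^sup>1 b'\<close> this Gaussian integral is \<open>1 / (1 - r\<^sup>2 \<alpha> \<beta>)\<close>
  (\<open>spiked_cross_moment\<close>), and its \<open>n\<close>-th power is at most
  \<open>exp (2 n r\<^sup>2 \<bar>\<alpha> \<beta>\<bar>) \<le> exp (\<zeta> p \<alpha>\<^sup>2) exp (\<zeta> q \<beta>\<^sup>2)\<close>.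

  For fixed \<open>a'\<close> the quantity \<open>\<surd>p \<alpha>\<close> is a random signed sum of coefficients with square sum at
  most \<open>M0\<^sup>2\<close>, so it is sub-Gaussian and the mean of \<open>exp (\<zeta> p \<alpha>\<^sup>2)\<close> is at most
  \<open>(1 - 2 \<zeta> M0\<^sup>2)\<^bsup>-1/2\<^esup>\<close> (\<open>rademacher_square_exponential\<close>); likewise for \<open>b\<close>.  The product of the two
  bounds tends to \<open>1\<close> as \<open>\<zeta> \<rightarrow> 0\<close>, uniformly in the dimensions and in the sample size.
\<close>

\<comment> \<open>From here on \<open>\<bullet>\<close> and \<open>$\<close> always refer to vectors of type \<open>real vec\<close>.\<close>
unbundle no inner_syntax and no vec_syntax

section \<open>Quadratic forms and extreme eigenvalues\<close>

abbreviation qform :: "real mat \<Rightarrow> real vec \<Rightarrow> real" where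
  "qform A v \<equiv> v \<bullet> (A *\<^sub>v v)"

lemma bilinear_expand:
  fixes A :: "real mat"
  assumes "A \<in> carrier_mat n n" "x \<in> carrier_vec n" "y \<in> carrier_vec n" "u \<in> carrier_vec n" "v \<in> carrier_vec n"
  shows "(s \<cdot>\<^sub>v x + t \<cdot>\<^sub>v y) \<bullet> (A *\<^sub>v (s' \<cdot>\<^sub>v u + t' \<cdot>\<^sub>v v)) =
    s * s' * (x \<bullet> (A *\<^sub>v u)) + s * t' * (x \<bullet> (A *\<^sub>v v)) + t * s' * (y \<bullet> (A *\<^sub>v u)) + t * t' * (y \<bullet> (A *\<^sub>v v))"
proof -
  have "A *\<^sub>v (s' \<cdot>\<^sub>v u + t' \<cdot>\<^sub>v v) = s' \<cdot>\<^sub>v (A *\<^sub>v u) + t' \<cdot>\<^sub>v (A *\<^sub>v v)"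
    using assms by (simp add: mult_add_distrib_mat_vec[of A n n] mult_mat_vec[of A n n])
  then show ?thesis
    using assms by (simp add: add_scalar_prod_distrib[of _ n] scalar_prod_add_distrib[of _ n] algebra_simps)
qed

lemma symmetric_bilinear:
  fixes A :: "real mat"
  assumes "A \<in> carrier_mat n n" "transpose_mat A = A" "x \<in> carrier_vec n" "y \<in> carrier_vec n"
  shows "x \<bullet> (A *\<^sub>v y) = y \<bullet> (A *\<^sub>v x)"
  using transpose_vec_mult_scalar[OF assms(1) assms(4,3)] assms
  by (metis comm_scalar_prod mult_mat_vec_carrier)

lemma nonneg_binary_form_discriminant:
  fixes X Y W :: real
  assumes "\<And>s t. s\<^sup>2 * X + 2 * s * t * W + t\<^sup>2 * Y \<ge> 0"
  shows "W\<^sup>2 \<le> X * Y"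
proof -
  have Y0: "Y \<ge> 0" using assms[of 0 1] by simp
  show ?thesis
  proof (cases "Y = 0")
    case False
    have "Y * (X * Y - W\<^sup>2) \<ge> 0"
      using assms[of Y "-W"] by (simp add: power2_eq_square algebra_simps)
    then show ?thesis using Y0 False by (simp add: zero_le_mult_iff)
  next
    case True
    have "W = 0"
    proof (rule ccontr)
      assume "W \<noteq> 0"
      then show False using assms[of 1 "- (X + 1) / (2 * W)"] True by (simp add: field_simps)
    qed
    then show ?thesis using True by simp
  qed
qed

text \<open>
  The discriminant inequality for the nonnegative binary form \<open>qform A (s x + t y)\<close> in \<open>s\<close> and \<open>t\<close>.
  Degenerate forms matter: a matrix shifted by its least eigenvalue is only semidefinite.
\<close>

lemma psd_cauchy_schwarz:
  fixes A :: "real mat"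
  assumes A: "A \<in> carrier_mat n n" "transpose_mat A = A"
    and psd: "\<And>x. x \<in> carrier_vec n \<Longrightarrow> qform A x \<ge> 0"
    and x: "x \<in> carrier_vec n" and y: "y \<in> carrier_vec n"
  shows "(x \<bullet> (A *\<^sub>v y))\<^sup>2 \<le> qform A x * qform A y"
proof (rule nonneg_binary_form_discriminant)
  fix s t :: real
  have "0 \<le> qform A (s \<cdot>\<^sub>v x + t \<cdot>\<^sub>v y)" using psd x y by simp
  also have "\<dots> = s\<^sup>2 * qform A x + 2 * s * t * (x \<bullet> (A *\<^sub>v y)) + t\<^sup>2 * qform A y"
    unfolding bilinear_expand[OF A(1) x y x y] symmetric_bilinear[OF A y x]
    by (simp add: power2_eq_square algebra_simps)
  finally show "s\<^sup>2 * qform A x + 2 * s * t * (x \<bullet> (A *\<^sub>v y)) + t\<^sup>2 * qform A y \<ge> 0" .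
qed

lemma vec_norm_nonneg: "(x :: real vec) \<bullet> x \<ge> 0"
  by (auto simp: scalar_prod_def intro!: sum_nonneg)

lemma vec_norm_pos:
  assumes x: "(x :: real vec) \<in> carrier_vec n" and "x \<noteq> 0\<^sub>v n"
  shows "x \<bullet> x > 0"
proof (rule ccontr)
  assume "\<not> x \<bullet> x > 0"
  then have "(\<Sum>i\<in>{0..<n}. x $ i * x $ i) = 0"
    using vec_norm_nonneg[of x] x by (simp add: scalar_prod_def)
  then have "\<forall>i\<in>{0..<n}. x $ i * x $ i = 0" by (subst (asm) sum_nonneg_eq_0_iff) auto
  then have "x = 0\<^sub>v n" using x by (intro eq_vecI) auto
  with assms(2) show False by simp
qed

lemma vec_cauchy_schwarz:
  assumes "(x :: real vec) \<in> carrier_vec n" "y \<in> carrier_vec n"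
  shows "(x \<bullet> y)\<^sup>2 \<le> (x \<bullet> x) * (y \<bullet> y)"
  using psd_cauchy_schwarz[of "1\<^sub>m n" n x y] assms vec_norm_nonneg by simp

lemma mult_mat_vec_bound:
  assumes A: "A \<in> carrier_mat n n"
  obtains K :: real where "K > 0"
    "\<And>x. x \<in> carrier_vec n \<Longrightarrow> (A *\<^sub>v x) \<bullet> (A *\<^sub>v x) \<le> K * (x \<bullet> x)"
proof
  let ?K = "1 + (\<Sum>i<n. row A i \<bullet> row A i)"
  show "?K > 0" by (smt (verit) sum_nonneg vec_norm_nonneg)
  fix x :: "real vec" assume x: "x \<in> carrier_vec n"
  have "(A *\<^sub>v x) \<bullet> (A *\<^sub>v x) = (\<Sum>i<n. (row A i \<bullet> x)\<^sup>2)"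
    using A by (simp add: scalar_prod_def[of "A *\<^sub>v x"] power2_eq_square atLeast0LessThan)
  also have "\<dots> \<le> (\<Sum>i<n. (row A i \<bullet> row A i) * (x \<bullet> x))"
    using A x by (intro sum_mono vec_cauchy_schwarz[of _ n]) auto
  also have "\<dots> \<le> ?K * (x \<bullet> x)"
    using vec_norm_nonneg[of x] by (simp add: sum_distrib_right[symmetric] mult_right_mono)
  finally show "(A *\<^sub>v x) \<bullet> (A *\<^sub>v x) \<le> ?K * (x \<bullet> x)" .
qed

lemma inverse_of_det_nonzero:
  fixes A :: "real mat"
  assumes A: "A \<in> carrier_mat n n" and d: "det A \<noteq> 0"
  obtains C where "mat_inverse A = Some C" "C \<in> carrier_mat n n" "A * C = 1\<^sub>m n" "C * A = 1\<^sub>m n"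
proof -
  have "A \<in> Units (ring_mat TYPE(real) n n)" by (rule det_non_zero_imp_unit[OF A d])
  then obtain C where C: "mat_inverse A = Some C" using mat_inverse(1)[OF A] by fastforce
  from mat_inverse(2)[OF A C] C show ?thesis using that by blast
qed


text \<open>
  The infimum \<open>k\<close> of the quadratic form on the unit sphere is an eigenvalue.  The matrix
  \<open>B = A - k I\<close> is semidefinite, so Cauchy-Schwarz for the form \<open>B\<close> gives
  \<open>\<parallel>B x\<parallel>\<^sup>2 \<le> const \<cdot> qform B x\<close>.  If \<open>B\<close> were invertible, the left side would be bounded below on the
  sphere, and the infimum of \<open>qform A\<close> would exceed \<open>k\<close>.
\<close>

lemma symmetric_least_eigenvalue:
  fixes A :: "real mat"
  assumes A: "A \<in> carrier_mat n n" "transpose_mat A = A" and n: "n \<ge> 1"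
  obtains k where "eigenvalue A k" "\<And>x. x \<in> carrier_vec n \<Longrightarrow> k * (x \<bullet> x) \<le> qform A x"
proof -
  define R where "R = {qform A x | x. x \<in> carrier_vec n \<and> x \<bullet> x = 1}"
  obtain K where K: "K > 0" "\<And>x. x \<in> carrier_vec n \<Longrightarrow> (A *\<^sub>v x) \<bullet> (A *\<^sub>v x) \<le> K * (x \<bullet> x)"
    using mult_mat_vec_bound[OF A(1)] by blast
  have bdd: "bdd_below R"
  proof (rule bdd_belowI)
    fix r assume "r \<in> R"
    then obtain x where x: "x \<in> carrier_vec n" "x \<bullet> x = 1" "r = qform A x" by (auto simp: R_def)
    have "r\<^sup>2 \<le> K" using vec_cauchy_schwarz[of x n "A *\<^sub>v x"] x A K(2)[of x] by simp
    then have "\<bar>r\<bar> \<le> sqrt K" by (rule real_le_rsqrt[of "\<bar>r\<bar>", simplified])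
    then show "- sqrt K \<le> r" by linarith
  qed
  have "qform A (unit_vec n 0) \<in> R" using n unfolding R_def by (intro CollectI exI[of _ "unit_vec n 0"]) (simp add: scalar_prod_left_unit)
  then have ne: "R \<noteq> {}" by blast
  define k where "k = Inf R"
  have low: "k * (x \<bullet> x) \<le> qform A x" if x: "x \<in> carrier_vec n" for x
  proof (cases "x = 0\<^sub>v n")
    case True
    then show ?thesis using A by simp
  next
    case False
    define c where "c = 1 / sqrt (x \<bullet> x)"
    have xx: "x \<bullet> x > 0" using vec_norm_pos[OF x False] .
    have c2: "c * c * (x \<bullet> x) = 1" using xx by (simp add: c_def)
    have "qform A (c \<cdot>\<^sub>v x) \<in> R" unfolding R_def
      using x c2 by (intro CollectI exI[of _ "c \<cdot>\<^sub>v x"]) (simp add: mult.assoc)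
    then have "k \<le> qform A (c \<cdot>\<^sub>v x)" unfolding k_def using bdd by (rule cInf_lower)
    also have "\<dots> = c * c * qform A x" using A x by (simp add: mult_mat_vec[of A n n])
    finally have "k * (x \<bullet> x) \<le> c * c * qform A x * (x \<bullet> x)" using xx by (simp add: mult_right_mono)
    also have "\<dots> = qform A x" using c2 by (metis mult.commute mult.left_commute mult_1)
    finally show ?thesis .
  qed
  have "eigenvalue A k"
  proof (rule ccontr)
    assume "\<not> eigenvalue A k"
    define B where "B = char_matrix A k"
    have B: "B \<in> carrier_mat n n" using A by (simp add: B_def)
    have Bx: "B *\<^sub>v x = A *\<^sub>v x + (-k) \<cdot>\<^sub>v x" if "x \<in> carrier_vec n" for x
      using A that unfolding B_def char_matrix_def
      by (intro eq_vecI) (auto simp: add_scalar_prod_distrib[of _ n])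
    have qB: "qform B x = qform A x - k * (x \<bullet> x)" if "x \<in> carrier_vec n" for x
      unfolding Bx[OF that] using A that by (simp add: scalar_prod_add_distrib[of _ n])
    have tB: "transpose_mat B = B" using A unfolding B_def char_matrix_def
      by (intro eq_matI) (auto simp: index_transpose_mat, metis index_transpose_mat(1) carrier_matD)
    have psd: "qform B x \<ge> 0" if "x \<in> carrier_vec n" for x using qB low that by simp
    have "det B \<noteq> 0" using \<open>\<not> eigenvalue A k\<close> eigenvalue_det[OF A(1)] by (simp add: B_def)
    then obtain C where C: "C \<in> carrier_mat n n" "C * B = 1\<^sub>m n" using inverse_of_det_nonzero[OF B] by metis
    obtain K1 where K1: "K1 > 0" "\<And>x. x \<in> carrier_vec n \<Longrightarrow> (C *\<^sub>v x) \<bullet> (C *\<^sub>v x) \<le> K1 * (x \<bullet> x)"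
      using mult_mat_vec_bound[OF C(1)] by blast
    obtain K2 where K2: "K2 > 0" "\<And>x. x \<in> carrier_vec n \<Longrightarrow> (B *\<^sub>v x) \<bullet> (B *\<^sub>v x) \<le> K2 * (x \<bullet> x)"
      using mult_mat_vec_bound[OF B] by blast
    \<comment> \<open>A spectral gap: \<open>K1\<close> bounds the inverse of \<open>B\<close> and \<open>K2\<close> bounds \<open>B\<close>.\<close>
    have gap: "1 / (K1 * sqrt K2) \<le> qform B x" if x: "x \<in> carrier_vec n" "x \<bullet> x = 1" for x
    proof -
      define y where "y = B *\<^sub>v x"
      have y: "y \<in> carrier_vec n" using B x by (simp add: y_def)
      have "x = C *\<^sub>v y" using B C x unfolding y_def by (metis assoc_mult_mat_vec one_mult_mat_vec)
      then have "1 \<le> K1 * (y \<bullet> y)" using K1(2)[OF y] x by simp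
      then have yy: "1 / K1 \<le> y \<bullet> y" using K1 by (simp add: field_simps)
      then have ypos: "y \<bullet> y > 0" using K1(1) by (smt (verit) divide_pos_pos)
      have "(y \<bullet> (B *\<^sub>v y))\<^sup>2 \<le> (y \<bullet> y) * ((B *\<^sub>v y) \<bullet> (B *\<^sub>v y))"
        using vec_cauchy_schwarz[of y n "B *\<^sub>v y"] y B by simp
      also have "\<dots> \<le> (y \<bullet> y) * (K2 * (y \<bullet> y))" using K2(2)[OF y] ypos by (simp add: mult_left_mono)
      also have "\<dots> = (sqrt K2 * (y \<bullet> y))\<^sup>2" using K2(1) by (simp add: power_mult_distrib power2_eq_square)
      finally have By: "qform B y \<le> sqrt K2 * (y \<bullet> y)" using ypos K2(1) by (auto intro: power2_le_imp_le)
      have "(y \<bullet> y)\<^sup>2 \<le> qform B y * qform B x"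
        using psd_cauchy_schwarz[OF B tB psd y x(1)] unfolding y_def by simp
      also have "\<dots> \<le> sqrt K2 * (y \<bullet> y) * qform B x" using By psd[OF x(1)] by (rule mult_right_mono)
      finally have "y \<bullet> y \<le> sqrt K2 * qform B x" using ypos by (simp add: power2_eq_square mult.assoc mult.left_commute)
      with yy have "1 / K1 \<le> sqrt K2 * qform B x" by linarith
      then show ?thesis using K1(1) K2(1) by (simp add: field_simps)
    qed
    have "k + 1 / (K1 * sqrt K2) \<le> Inf R"
    proof (rule cInf_greatest[OF ne])
      fix r assume "r \<in> R"
      then obtain x where x: "x \<in> carrier_vec n" "x \<bullet> x = 1" "r = qform A x" by (auto simp: R_def)
      then show "k + 1 / (K1 * sqrt K2) \<le> r" using gap[OF x(1,2)] qB[OF x(1)] by simp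
    qed
    moreover have "1 / (K1 * sqrt K2) > 0" using K1(1) K2(1) by simp
    ultimately show False unfolding k_def by linarith
  qed
  with low that show ?thesis by blast
qed

lemma finite_eigenvalues:
  assumes A: "(A :: real mat) \<in> carrier_mat n n"
  shows "finite {k. eigenvalue A k}"
  unfolding eigenvalue_root_char_poly[OF A]
  by (rule poly_roots_finite) (use degree_monic_char_poly[OF A] in auto)

lemma eigenvalue_rayleigh:
  assumes A: "(A :: real mat) \<in> carrier_mat n n" and "eigenvalue A k"
  obtains x where "x \<in> carrier_vec n" "x \<bullet> x > 0" "qform A x = k * (x \<bullet> x)"
  using assms vec_norm_pos unfolding eigenvalue_def eigenvector_def by fastforce

text \<open>
  Turns the spectral conditions on covariance matrices into inequalities between quadratic forms,
  the only form in which they are used.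
\<close>

lemma lambda_min_ge_iff:
  fixes A :: "real mat"
  assumes A: "A \<in> carrier_mat n n" "transpose_mat A = A" and n: "n \<ge> 1"
  shows "m \<le> lambda_min A \<longleftrightarrow> (\<forall>x \<in> carrier_vec n. m * (x \<bullet> x) \<le> qform A x)"
proof -
  obtain k where k: "eigenvalue A k" "\<And>x. x \<in> carrier_vec n \<Longrightarrow> k * (x \<bullet> x) \<le> qform A x"
    using symmetric_least_eigenvalue[OF A n] by blast
  have "k \<le> k'" if ev: "eigenvalue A k'" for k'
  proof -
    obtain x where x: "x \<in> carrier_vec n" "x \<bullet> x > 0" "qform A x = k' * (x \<bullet> x)"
      using eigenvalue_rayleigh[OF A(1) ev] by blast
    then show ?thesis using k(2)[of x] by simp
  qed
  then have lk: "lambda_min A = k"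
    unfolding lambda_min_def using k(1) finite_eigenvalues[OF A(1)] by (intro Min_eqI) auto
  obtain x where x: "x \<in> carrier_vec n" "x \<bullet> x > 0" "qform A x = k * (x \<bullet> x)"
    using eigenvalue_rayleigh[OF A(1) k(1)] by blast
  show ?thesis unfolding lk
  proof
    assume "m \<le> k"
    then show "\<forall>x \<in> carrier_vec n. m * (x \<bullet> x) \<le> qform A x"
      using k(2) vec_norm_nonneg by (meson mult_right_mono order_trans)
  next
    assume "\<forall>x \<in> carrier_vec n. m * (x \<bullet> x) \<le> qform A x"
    with x show "m \<le> k" by fastforce
  qed
qed

lemma lambda_max_eq_uminus:
  fixes A :: "real mat"
  assumes A: "A \<in> carrier_mat n n" "transpose_mat A = A" and n: "n \<ge> 1"
  shows "lambda_max A = - lambda_min (- A)"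
proof -
  have neg: "eigenvalue (- B) (- k)" if B: "eigenvalue B k" "B \<in> carrier_mat n n" for B :: "real mat" and k
  proof -
    obtain v where v: "v \<in> carrier_vec n" "v \<noteq> 0\<^sub>v n" "B *\<^sub>v v = k \<cdot>\<^sub>v v"
      using B(1) unfolding eigenvalue_def eigenvector_def carrier_matD[OF B(2)] by blast
    have "- B *\<^sub>v v = - (k \<cdot>\<^sub>v v)" using B v by simp
    also have "\<dots> = (- k) \<cdot>\<^sub>v v" by (intro eq_vecI) auto
    finally show ?thesis using v B unfolding eigenvalue_def eigenvector_def by auto
  qed
  have AA: "- (- A) = A" by (intro eq_matI) auto
  have "eigenvalue (- A) k \<longleftrightarrow> eigenvalue A (- k)" for k
    using neg[of A "- k"] neg[of "- A" k] A AA by auto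
  then have "{k. eigenvalue (- A) k} = uminus ` {k. eigenvalue A k}"
    using image_iff minus_minus by fastforce
  moreover obtain k where "eigenvalue A k" using symmetric_least_eigenvalue[OF A n] by blast
  then have "{k. eigenvalue A k} \<noteq> {}" by blast
  ultimately show ?thesis
    unfolding lambda_max_def lambda_min_def
    using minus_Max_eq_Min[OF finite_eigenvalues[OF A(1)]] by simp
qed

lemma lambda_max_le_iff:
  fixes A :: "real mat"
  assumes A: "A \<in> carrier_mat n n" "transpose_mat A = A" and n: "n \<ge> 1"
  shows "lambda_max A \<le> m \<longleftrightarrow> (\<forall>x \<in> carrier_vec n. qform A x \<le> m * (x \<bullet> x))"
proof -
  have "lambda_max A \<le> m \<longleftrightarrow> - m \<le> lambda_min (- A)"
    unfolding lambda_max_eq_uminus[OF A n] by linarith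
  also have "\<dots> \<longleftrightarrow> (\<forall>x \<in> carrier_vec n. - m * (x \<bullet> x) \<le> qform (- A) x)"
    using A n by (intro lambda_min_ge_iff) (auto simp: transpose_uminus)
  also have "\<dots> \<longleftrightarrow> (\<forall>x \<in> carrier_vec n. qform A x \<le> m * (x \<bullet> x))"
  proof (rule ball_cong[OF refl])
    fix x :: "real vec" assume x: "x \<in> carrier_vec n"
    have "qform (- A) x = - qform A x" using A x by simp
    then show "(- m * (x \<bullet> x) \<le> qform (- A) x) = (qform A x \<le> m * (x \<bullet> x))" by simp
  qed
  finally show ?thesis .
qed

section \<open>Determinants and the Gaussian integral\<close>

definition pos_def :: "nat \<Rightarrow> real mat \<Rightarrow> bool" where
  "pos_def n A \<longleftrightarrow> A \<in> carrier_mat n n \<and> transpose_mat A = A \<and>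
     (\<forall>x \<in> carrier_vec n. x \<noteq> 0\<^sub>v n \<longrightarrow> qform A x > 0)"

lemma symmetric_index:
  assumes "A \<in> carrier_mat n n" "transpose_mat A = A" "i < n" "j < n"
  shows "A $$ (i, j) = A $$ (j, i)"
  using assms by (metis carrier_matD index_transpose_mat(1))

lemma qform_as_sum:
  assumes "A \<in> carrier_mat n n" "x \<in> carrier_vec n"
  shows "qform A x = (\<Sum>i<n. \<Sum>j<n. A $$ (i, j) * x $ i * x $ j)"
  using assms by (auto simp: scalar_prod_def atLeast0LessThan sum_distrib_left intro!: sum.cong)

text \<open>
  The Schur complement of the last diagonal entry: what remains of the quadratic form \<open>Q\<close> after
  the last variable has been eliminated by completing the square.
\<close>

definition schur_last :: "nat \<Rightarrow> real mat \<Rightarrow> real mat" where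
  "schur_last d Q = mat d d (\<lambda>(i, j). Q $$ (i, j) - Q $$ (i, d) * Q $$ (d, j) / Q $$ (d, d))"

lemma schur_last_carrier [simp]: "schur_last d Q \<in> carrier_mat d d"
  by (simp add: schur_last_def)

text \<open>
  A block elimination step: the last column clears the rest of the last row.
\<close>

lemma det_schur_last:
  assumes Q: "Q \<in> carrier_mat (Suc d) (Suc d)" and c: "Q $$ (d, d) \<noteq> 0"
  shows "det Q = Q $$ (d, d) * det (schur_last d Q)"
proof -
  define A where "A = mat d d (\<lambda>ij. Q $$ ij)"
  define B where "B = mat d 1 (\<lambda>(i, j). Q $$ (i, d))"
  define C where "C = mat 1 d (\<lambda>(i, j). Q $$ (d, j))"
  define D where "D = mat 1 1 (\<lambda>(i, j). Q $$ (d, d))"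
  define R where "R = mat 1 d (\<lambda>(i, j). - Q $$ (d, j) / Q $$ (d, d))"
  note defs = A_def B_def C_def D_def R_def
  have car: "A \<in> carrier_mat d d" "B \<in> carrier_mat d 1" "C \<in> carrier_mat 1 d" "D \<in> carrier_mat 1 1"
    "R \<in> carrier_mat 1 d" by (auto simp: defs)
  have Qb: "Q = four_block_mat A B C D"
    using Q by (intro eq_matI) (auto simp: defs less_Suc_eq)
  define L where "L = four_block_mat (1\<^sub>m d) (0\<^sub>m d 1) R (1\<^sub>m 1)"
  have dL: "det L = 1" unfolding L_def
    by (subst det_four_block_mat_upper_right_zero[OF _ refl]) (use car in auto)
  have Lc: "L \<in> carrier_mat (Suc d) (Suc d)" unfolding L_def using four_block_carrier_mat[of "1\<^sub>m d" d d "1\<^sub>m 1" 1 1] by simp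
  have "Q * L = four_block_mat (A * 1\<^sub>m d + B * R) (A * 0\<^sub>m d 1 + B * 1\<^sub>m 1) (C * 1\<^sub>m d + D * R) (C * 0\<^sub>m d 1 + D * 1\<^sub>m 1)"
    unfolding Qb L_def by (rule mult_four_block_mat) (use car in auto)
  also have "A * 1\<^sub>m d + B * R = schur_last d Q"
    by (intro eq_matI) (auto simp: defs schur_last_def scalar_prod_def)
  also have "A * 0\<^sub>m d 1 + B * 1\<^sub>m 1 = B" using car by simp
  also have "C * 1\<^sub>m d + D * R = 0\<^sub>m 1 d"
    using c by (intro eq_matI) (auto simp: defs scalar_prod_def)
  also have "C * 0\<^sub>m d 1 + D * 1\<^sub>m 1 = D" using car by simp
  finally have QL: "Q * L = four_block_mat (schur_last d Q) B (0\<^sub>m 1 d) D" .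
  have "det Q = det (Q * L)" using det_mult[OF Q Lc] dL by simp
  also have "\<dots> = det (schur_last d Q) * det D" unfolding QL
    by (rule det_four_block_mat_lower_left_zero) (use car in auto)
  also have "det D = Q $$ (d, d)" by (subst det_single) (auto simp: D_def)
  finally show ?thesis by simp
qed

definition outer :: "nat \<Rightarrow> real vec \<Rightarrow> real vec \<Rightarrow> real mat" where
  "outer n a b = mat n n (\<lambda>(i, j). a $ i * b $ j)"

lemma outer_carrier [simp]: "outer n a b \<in> carrier_mat n n"
  by (simp add: outer_def)

lemma outer_mult_vec:
  assumes "a \<in> carrier_vec n" "b \<in> carrier_vec n" "x \<in> carrier_vec n"
  shows "outer n a b *\<^sub>v x = (b \<bullet> x) \<cdot>\<^sub>v a"
  using assms by (intro eq_vecI) (auto simp: outer_def scalar_prod_def sum_distrib_left mult_ac)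

text \<open>
  Both sides are the determinant of the bordered matrix with blocks \<open>I\<close>, \<open>y\<close>, \<open>e\<^sup>T\<close>, \<open>1\<close>, eliminated
  once from its last entry and once from its identity block.
\<close>

lemma det_one_minus_outer:
  assumes y: "y \<in> carrier_vec n" and e: "e \<in> carrier_vec n"
  shows "det (1\<^sub>m n - outer n y e) = 1 - e \<bullet> y"
proof -
  define Y where "Y = mat n 1 (\<lambda>(i, j). y $ i)"
  define E where "E = mat 1 n (\<lambda>(i, j). e $ j)"
  define D where "D = mat 1 1 (\<lambda>(i, j). 1 - e \<bullet> y)"
  have car: "Y \<in> carrier_mat n 1" "E \<in> carrier_mat 1 n" "D \<in> carrier_mat 1 1"
    by (auto simp: Y_def E_def D_def)
  define M where "M = four_block_mat (1\<^sub>m n) Y E (1\<^sub>m 1)"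
  define L where "L = four_block_mat (1\<^sub>m n) (0\<^sub>m n 1) E (1\<^sub>m 1)"
  define U where "U = four_block_mat (1\<^sub>m n) Y (0\<^sub>m 1 n) D"
  have M: "M \<in> carrier_mat (Suc n) (Suc n)" "L \<in> carrier_mat (Suc n) (Suc n)" "U \<in> carrier_mat (Suc n) (Suc n)"
    unfolding M_def L_def U_def Suc_eq_plus1 by (rule four_block_carrier_mat, use car in simp, use car in simp)+
  have "L * U = four_block_mat (1\<^sub>m n * 1\<^sub>m n + 0\<^sub>m n 1 * 0\<^sub>m 1 n) (1\<^sub>m n * Y + 0\<^sub>m n 1 * D)
       (E * 1\<^sub>m n + 1\<^sub>m 1 * 0\<^sub>m 1 n) (E * Y + 1\<^sub>m 1 * D)"
    unfolding L_def U_def by (rule mult_four_block_mat) (use car in auto)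
  also have "E * Y + 1\<^sub>m 1 * D = 1\<^sub>m 1"
    using y e by (intro eq_matI) (auto simp: Y_def E_def D_def scalar_prod_def)
  finally have "M = L * U" using car unfolding M_def by simp
  then have "det M = det L * det U" using det_mult[OF M(2,3)] by simp
  also have "det L = 1" unfolding L_def
    by (subst det_four_block_mat_upper_right_zero[OF _ refl]) (use car in auto)
  also have "det U = det D" unfolding U_def
    by (subst det_four_block_mat_lower_left_zero[OF _ _ refl]) (use car in auto)
  also have "det D = 1 - e \<bullet> y" by (subst det_single) (auto simp: D_def)
  finally have "det M = 1 - e \<bullet> y" by simp
  moreover have "schur_last n M = 1\<^sub>m n - outer n y e"
    by (intro eq_matI) (auto simp: schur_last_def outer_def M_def Y_def E_def)
  moreover have "M $$ (n, n) = 1" by (auto simp: M_def Y_def E_def)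
  ultimately show ?thesis using det_schur_last[OF M(1)] by simp
qed

lemma qform_complete_square:
  assumes Q: "Q \<in> carrier_mat (Suc d) (Suc d)" "transpose_mat Q = Q" and c: "Q $$ (d, d) \<noteq> 0"
  shows "qform Q (vec (Suc d) (x(d := y))) =
    qform (schur_last d Q) (vec d x) + Q $$ (d, d) * (y + (\<Sum>i<d. Q $$ (i, d) * x i) / Q $$ (d, d))\<^sup>2"
proof -
  define c where "c = Q $$ (d, d)"
  define b where "b = (\<Sum>i<d. Q $$ (i, d) * x i)"
  have b': "(\<Sum>i<d. Q $$ (d, i) * x i) = b"
    unfolding b_def using symmetric_index[OF Q, of d] by (intro sum.cong) auto
  have "qform Q (vec (Suc d) (x(d := y))) =
      (\<Sum>i<d. \<Sum>j<d. Q $$ (i, j) * x i * x j) + (\<Sum>i<d. Q $$ (i, d) * x i * y) + (\<Sum>j<d. Q $$ (d, j) * y * x j) + c * y * y"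
    unfolding qform_as_sum[OF Q(1) vec_carrier] c_def by (simp add: sum.distrib)
  also have "(\<Sum>i<d. Q $$ (i, d) * x i * y) = b * y" by (simp add: b_def sum_distrib_right)
  also have "(\<Sum>j<d. Q $$ (d, j) * y * x j) = b * y" unfolding b'[symmetric] by (simp add: sum_distrib_right sum_distrib_left mult_ac)
  finally have 1: "qform Q (vec (Suc d) (x(d := y))) = (\<Sum>i<d. \<Sum>j<d. Q $$ (i, j) * x i * x j) + 2 * b * y + c * y * y"
    by (simp only: mult.assoc mult_2 distrib_right)
  have "qform (schur_last d Q) (vec d x) = (\<Sum>i<d. \<Sum>j<d. Q $$ (i, j) * x i * x j - (Q $$ (i, d) * x i) * (Q $$ (d, j) * x j) / c)"
    unfolding qform_as_sum[OF schur_last_carrier vec_carrier]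
    by (intro sum.cong refl) (simp add: schur_last_def c_def algebra_simps)
  also have "\<dots> = (\<Sum>i<d. \<Sum>j<d. Q $$ (i, j) * x i * x j) - (\<Sum>i<d. \<Sum>j<d. (Q $$ (i, d) * x i) * (Q $$ (d, j) * x j)) / c"
    by (simp add: sum_subtractf sum_divide_distrib)
  also have "(\<Sum>i<d. \<Sum>j<d. (Q $$ (i, d) * x i) * (Q $$ (d, j) * x j)) = b * b"
    unfolding sum_product[symmetric] b' by (simp add: b_def)
  finally have 2: "qform (schur_last d Q) (vec d x) = (\<Sum>i<d. \<Sum>j<d. Q $$ (i, j) * x i * x j) - b * b / c" .
  have 3: "c * (y + b / c)\<^sup>2 = c * y * y + 2 * b * y + b * b / c"
    using c unfolding c_def[symmetric] by (simp add: power2_eq_square field_simps)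
  show ?thesis unfolding 1 2 b_def[symmetric] c_def[symmetric] 3 by simp
qed

lemma gaussian_integral_1d:
  fixes c m :: real
  assumes c: "c > 0"
  shows "(\<integral>\<^sup>+ y. ennreal (exp (- (c * (y + m)\<^sup>2) / 2)) \<partial>lborel) = ennreal (sqrt (2 * pi / c))"
proof -
  define \<sigma> where "\<sigma> = 1 / sqrt c"
  have s: "\<sigma> > 0" "\<sigma>\<^sup>2 = 1 / c" using c by (auto simp: \<sigma>_def power_divide)
  have e: "exp (- (c * (y + m)\<^sup>2) / 2) = sqrt (2 * pi / c) * normal_density (- m) \<sigma> y" for y
    using c by (simp add: normal_density_def s(2) real_sqrt_divide real_sqrt_mult field_simps)
  have "(\<integral>\<^sup>+ y. ennreal (exp (- (c * (y + m)\<^sup>2) / 2)) \<partial>lborel) = (\<integral>\<^sup>+ y. ennreal (sqrt (2 * pi / c)) * ennreal (normal_density (- m) \<sigma> y) \<partial>lborel)"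
    unfolding e using c by (simp add: ennreal_mult)
  also have "\<dots> = ennreal (sqrt (2 * pi / c)) * (\<integral>\<^sup>+ y. ennreal (normal_density (- m) \<sigma> y) \<partial>lborel)"
    by (rule nn_integral_cmult) simp
  also have "(\<integral>\<^sup>+ y. ennreal (normal_density (- m) \<sigma> y) \<partial>lborel) = 1"
    using s by (subst nn_integral_eq_integral) auto
  finally show ?thesis by simp
qed

lemma qform_measurable:
  "A \<in> carrier_mat d d \<Longrightarrow> (\<lambda>x. qform A (vec d x)) \<in> borel_measurable (PiM {..<d} (\<lambda>_. lborel))"
  unfolding qform_as_sum[OF _ vec_carrier] by (intro borel_measurable_sum) (auto intro!: borel_measurable_times)

lemma gaussian_kernel_measurable:
  assumes A: "A \<in> carrier_mat d d"
  shows "(\<lambda>x. ennreal (exp (- qform A (vec d x) / 2))) \<in> borel_measurable (PiM {..<d} (\<lambda>_. lborel))"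
proof -
  note [measurable] = qform_measurable[OF A]
  show ?thesis by measurable
qed

lemma pos_def_schur_last:
  assumes Q: "pos_def (Suc d) Q"
  shows "Q $$ (d, d) > 0" "pos_def d (schur_last d Q)"
proof -
  have Qc: "Q \<in> carrier_mat (Suc d) (Suc d)" "transpose_mat Q = Q" using Q by (auto simp: pos_def_def)
  have "qform Q (unit_vec (Suc d) d) > 0" using Q unfolding pos_def_def by simp
  also have "qform Q (unit_vec (Suc d) d) = Q $$ (d, d)"
    using Qc(1) by (simp add: scalar_prod_left_unit[of _ "Suc d"])
  finally show c: "Q $$ (d, d) > 0" .
  show "pos_def d (schur_last d Q)" unfolding pos_def_def
  proof (intro conjI ballI impI)
    show "schur_last d Q \<in> carrier_mat d d" by simp
    show "transpose_mat (schur_last d Q) = schur_last d Q"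
      by (intro eq_matI) (auto simp: schur_last_def symmetric_index[OF Qc])
    fix v :: "real vec" assume v: "v \<in> carrier_vec d" "v \<noteq> 0\<^sub>v d"
    define y where "y = - (\<Sum>i<d. Q $$ (i, d) * v $ i) / Q $$ (d, d)"
    have vv: "vec d (($) v) = v" using v by (intro eq_vecI) auto
    define z where "z = vec (Suc d) ((($) v)(d := y))"
    obtain i where i: "i < d" "v $ i \<noteq> 0" using v by (metis carrier_vecD eq_vecI index_zero_vec)
    have "z $ i \<noteq> 0" using i by (simp add: z_def)
    then have "z \<noteq> 0\<^sub>v (Suc d)" using i by auto
    then have "qform Q z > 0" using Q unfolding pos_def_def z_def by auto
    then show "qform (schur_last d Q) v > 0"
      using qform_complete_square[OF Qc, of "($) v" y] c unfolding z_def vv by (simp add: y_def)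
  qed
qed

text \<open>
  Induction on the dimension: integrating out the last coordinate after completing the square
  leaves the Gaussian integral of the Schur complement, and the determinant splits in the same way.
  Positivity of the determinant comes out of the same induction.
\<close>

proposition gaussian_integral:
  assumes "pos_def d Q"
  shows "det Q > 0 \<and> (\<integral>\<^sup>+ x. ennreal (exp (- qform Q (vec d x) / 2)) \<partial>PiM {..<d} (\<lambda>_. lborel))
           = ennreal (sqrt ((2 * pi) ^ d / det Q))"
  using assms
proof (induction d arbitrary: Q)
  case 0
  interpret product_sigma_finite "\<lambda>_::nat. lborel :: real measure" ..
  from 0 have Q: "Q \<in> carrier_mat 0 0" by (simp add: pos_def_def)
  have "qform Q (vec 0 x) = 0" for x using Q by (simp add: scalar_prod_def)
  moreover have "det Q = 1" using Q by (rule det_dim_zero)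
  moreover have "PiM {..<0::nat} (\<lambda>_. lborel :: real measure) = count_space {\<lambda>_. undefined}"
    by (simp only: lessThan_0 PiM_empty)
  ultimately show ?case by (simp add: nn_integral_count_space_finite del: lessThan_0)
next
  case (Suc d)
  interpret product_sigma_finite "\<lambda>_::nat. lborel :: real measure" ..
  have Qc: "Q \<in> carrier_mat (Suc d) (Suc d)" "transpose_mat Q = Q" using Suc.prems by (auto simp: pos_def_def)
  note c = pos_def_schur_last(1)[OF Suc.prems] and S = pos_def_schur_last(2)[OF Suc.prems]
  define K where "K = sqrt (2 * pi / Q $$ (d, d))"
  have dQ: "det Q = Q $$ (d, d) * det (schur_last d Q)" using det_schur_last[OF Qc(1)] c by simp
  have ins: "{..<Suc d} = insert d {..<d}" by auto
  note IH = Suc.IH[OF S]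
  have meas: "(\<lambda>x. ennreal (exp (- qform Q (vec (Suc d) x) / 2))) \<in> borel_measurable (PiM {..<Suc d} (\<lambda>_. lborel))"
    by (rule gaussian_kernel_measurable[OF Qc(1)])
  have "(\<integral>\<^sup>+ x. ennreal (exp (- qform Q (vec (Suc d) x) / 2)) \<partial>PiM {..<Suc d} (\<lambda>_. lborel))
      = (\<integral>\<^sup>+ x. (\<integral>\<^sup>+ y. ennreal (exp (- qform Q (vec (Suc d) (x(d := y))) / 2)) \<partial>lborel) \<partial>PiM {..<d} (\<lambda>_. lborel))"
    unfolding ins by (rule product_nn_integral_insert) (use meas[unfolded ins] in simp_all)
  also have "\<dots> = (\<integral>\<^sup>+ x. ennreal K * ennreal (exp (- qform (schur_last d Q) (vec d x) / 2)) \<partial>PiM {..<d} (\<lambda>_. lborel))"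
  proof (intro nn_integral_cong)
    fix x :: "nat \<Rightarrow> real"
    define m where "m = (\<Sum>i<d. Q $$ (i, d) * x i) / Q $$ (d, d)"
    have "(\<integral>\<^sup>+ y. ennreal (exp (- qform Q (vec (Suc d) (x(d := y))) / 2)) \<partial>lborel)
      = (\<integral>\<^sup>+ y. ennreal (exp (- qform (schur_last d Q) (vec d x) / 2)) * ennreal (exp (- (Q $$ (d, d) * (y + m)\<^sup>2) / 2)) \<partial>lborel)"
      using c by (simp add: qform_complete_square[OF Qc] m_def ennreal_mult[symmetric] exp_add[symmetric] diff_divide_distrib)
    also have "\<dots> = ennreal (exp (- qform (schur_last d Q) (vec d x) / 2)) * ennreal K"
      unfolding K_def gaussian_integral_1d[OF c, of m, symmetric] by (rule nn_integral_cmult) simp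
    finally show "(\<integral>\<^sup>+ y. ennreal (exp (- qform Q (vec (Suc d) (x(d := y))) / 2)) \<partial>lborel)
      = ennreal K * ennreal (exp (- qform (schur_last d Q) (vec d x) / 2))" by (simp add: mult.commute)
  qed
  also have "\<dots> = ennreal K * ennreal (sqrt ((2 * pi) ^ d / det (schur_last d Q)))"
    using IH by (simp only: nn_integral_cmult[OF gaussian_kernel_measurable[OF schur_last_carrier]])
  also have "\<dots> = ennreal (K * sqrt ((2 * pi) ^ d / det (schur_last d Q)))"
    by (rule ennreal_mult[symmetric]) (use c IH in \<open>auto simp: K_def\<close>)
  also have "K * sqrt ((2 * pi) ^ d / det (schur_last d Q)) = sqrt ((2 * pi) ^ Suc d / det Q)"
    unfolding K_def dQ real_sqrt_mult[symmetric] by simp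
  finally show ?case using mult_pos_pos[OF c, of "det (schur_last d Q)"] IH unfolding dQ by blast
qed

section \<open>Cross moments of normal densities\<close>

lemma pos_def_invertible:
  assumes S: "pos_def n S"
  obtains C where "mat_inverse S = Some C" "pos_def n C" "S * C = 1\<^sub>m n" "C * S = 1\<^sub>m n" "det C = 1 / det S"
proof -
  have Sc: "S \<in> carrier_mat n n" "transpose_mat S = S" using S by (auto simp: pos_def_def)
  have dS: "det S > 0" using gaussian_integral[OF S] by simp
  obtain C where C: "mat_inverse S = Some C" "C \<in> carrier_mat n n" "S * C = 1\<^sub>m n" "C * S = 1\<^sub>m n"
    using inverse_of_det_nonzero[OF Sc(1)] dS by (metis less_irrefl)
  have "transpose_mat C * S = 1\<^sub>m n"
    using transpose_mult[OF Sc(1) C(2)] C(3) Sc(2) by (metis transpose_one)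
  then have "transpose_mat C = C"
    using C Sc by (metis assoc_mult_mat left_mult_one_mat right_mult_one_mat transpose_carrier_mat)
  moreover have "qform C x > 0" if x: "x \<in> carrier_vec n" "x \<noteq> 0\<^sub>v n" for x
  proof -
    define y where "y = C *\<^sub>v x"
    have y: "y \<in> carrier_vec n" using C x by (simp add: y_def)
    have Sy: "S *\<^sub>v y = x" unfolding y_def using C Sc x by (metis assoc_mult_mat_vec one_mult_mat_vec)
    have "S *\<^sub>v 0\<^sub>v n = 0\<^sub>v n" using Sc by auto
    with Sy x have "y \<noteq> 0\<^sub>v n" by metis
    then have "qform S y > 0" using S y by (simp add: pos_def_def)
    then show ?thesis using comm_scalar_prod[OF x(1) y] Sy by (simp add: y_def)
  qed
  ultimately have "pos_def n C" using C by (simp add: pos_def_def)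
  moreover have "det S * det C = 1" using det_mult[OF Sc(1) C(2)] C(3) by simp
  then have "det C = 1 / det S" using dS by (simp add: field_simps)
  ultimately show ?thesis using that C by blast
qed

lemma mvn_density_eq:
  assumes "mat_inverse S = Some C"
  shows "mvn_density d S x = exp (- qform C (vec d x) / 2) / sqrt ((2 * pi) ^ d * det S)"
  by (simp add: mvn_density_def assms)

lemma mvn_density_pos: "pos_def d S \<Longrightarrow> mvn_density d S x > 0"
  using gaussian_integral[of d S] by (simp add: mvn_density_def)

lemma mvn_density_measurable:
  assumes S: "pos_def d S"
  shows "mvn_density d S \<in> borel_measurable (PiM {..<d} (\<lambda>_. lborel))"
proof -
  obtain C where C: "mat_inverse S = Some C" "pos_def d C" using pos_def_invertible[OF S] by metis
  have "C \<in> carrier_mat d d" using C by (simp add: pos_def_def)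
  note [measurable] = qform_measurable[OF this]
  show ?thesis unfolding mvn_density_eq[OF C(1)] by measurable
qed

lemma nn_integral_mvn_density:
  assumes S: "pos_def d S"
  shows "(\<integral>\<^sup>+ x. ennreal (mvn_density d S x) \<partial>PiM {..<d} (\<lambda>_. lborel)) = 1"
proof -
  obtain C where C: "mat_inverse S = Some C" "pos_def d C" "det C = 1 / det S" using pos_def_invertible[OF S] by metis
  have Cc: "C \<in> carrier_mat d d" using C by (simp add: pos_def_def)
  have dS: "det S > 0" using gaussian_integral[OF S] by simp
  define K where "K = sqrt ((2 * pi) ^ d * det S)"
  have K: "K > 0" using dS by (simp add: K_def)
  have "(\<integral>\<^sup>+ x. ennreal (mvn_density d S x) \<partial>PiM {..<d} (\<lambda>_. lborel))
      = (\<integral>\<^sup>+ x. ennreal (1 / K) * ennreal (exp (- qform C (vec d x) / 2)) \<partial>PiM {..<d} (\<lambda>_. lborel))"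
    unfolding mvn_density_eq[OF C(1)] K_def[symmetric] using K by (intro nn_integral_cong) (simp add: ennreal_mult[symmetric])
  also have "\<dots> = ennreal (1 / K) * ennreal (sqrt ((2 * pi) ^ d / det C))"
    using gaussian_integral[OF C(2)] by (simp only: nn_integral_cmult[OF gaussian_kernel_measurable[OF Cc]])
  also have "\<dots> = ennreal (1 / K * K)"
    unfolding C(3) using K by (simp add: K_def ennreal_mult[symmetric])
  finally show ?thesis using K by simp
qed

lemma mat_eq_by_vectors:
  assumes A: "A \<in> carrier_mat n n" and B: "B \<in> carrier_mat n n"
    and eq: "\<And>x :: real vec. x \<in> carrier_vec n \<Longrightarrow> A *\<^sub>v x = B *\<^sub>v x"
  shows "A = B"
proof (rule eq_matI)
  fix i j assume ij: "i < dim_row B" "j < dim_col B"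
  have "(A *\<^sub>v unit_vec n j) $ i = (B *\<^sub>v unit_vec n j) $ i" using eq by simp
  then show "A $$ (i, j) = B $$ (i, j)" using A B ij by (simp add: scalar_prod_right_unit)
qed (use A B in auto)

text \<open>
  The covariance matrix \<open>S + r (a b\<^sup>T + b a\<^sup>T)\<close>.
\<close>

definition spiked :: "nat \<Rightarrow> real mat \<Rightarrow> real \<Rightarrow> real vec \<Rightarrow> real vec \<Rightarrow> real mat" where
  "spiked n S r a b = mat n n (\<lambda>(i, j). S $$ (i, j) + r * (a $ i * b $ j + b $ i * a $ j))"

lemma spiked_carrier [simp]: "spiked n S r a b \<in> carrier_mat n n"
  by (simp add: spiked_def)

lemma spiked_symmetric:
  assumes "S \<in> carrier_mat n n" "transpose_mat S = S"
  shows "transpose_mat (spiked n S r a b) = spiked n S r a b"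
  by (intro eq_matI) (auto simp: spiked_def symmetric_index[OF assms])

lemma spiked_mult_vec:
  assumes "S \<in> carrier_mat n n" "a \<in> carrier_vec n" "b \<in> carrier_vec n" "x \<in> carrier_vec n"
  shows "spiked n S r a b *\<^sub>v x = S *\<^sub>v x + ((r * (b \<bullet> x)) \<cdot>\<^sub>v a + (r * (a \<bullet> x)) \<cdot>\<^sub>v b)"
  using assms by (intro eq_vecI)
    (auto simp: spiked_def scalar_prod_def sum.distrib sum_distrib_left algebra_simps)

lemma qform_spiked:
  assumes "S \<in> carrier_mat n n" "a \<in> carrier_vec n" "b \<in> carrier_vec n" "x \<in> carrier_vec n"
  shows "qform (spiked n S r a b) x = qform S x + 2 * r * (a \<bullet> x) * (b \<bullet> x)"
  unfolding spiked_mult_vec[OF assms] using assms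
  by (simp add: scalar_prod_add_distrib[of _ n] comm_scalar_prod[of x n])

lemma qform_spiked_bound:
  assumes S: "S \<in> carrier_mat n n" and a: "a \<in> carrier_vec n" "a \<bullet> a = 1" and b: "b \<in> carrier_vec n" "b \<bullet> b = 1"
    and x: "x \<in> carrier_vec n" and r: "r \<ge> 0"
  shows "\<bar>qform (spiked n S r a b) x - qform S x\<bar> \<le> 2 * r * (x \<bullet> x)"
proof -
  have "(a \<bullet> x)\<^sup>2 \<le> x \<bullet> x" "(b \<bullet> x)\<^sup>2 \<le> x \<bullet> x"
    using vec_cauchy_schwarz[OF a(1) x] vec_cauchy_schwarz[OF b(1) x] a b by simp_all
  moreover have "2 * \<bar>(a \<bullet> x) * (b \<bullet> x)\<bar> \<le> (a \<bullet> x)\<^sup>2 + (b \<bullet> x)\<^sup>2"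
    using sum_squares_bound[of "\<bar>a \<bullet> x\<bar>" "\<bar>b \<bullet> x\<bar>"] by (simp add: abs_mult)
  ultimately have "\<bar>(a \<bullet> x) * (b \<bullet> x)\<bar> \<le> x \<bullet> x" by linarith
  then have "2 * r * \<bar>(a \<bullet> x) * (b \<bullet> x)\<bar> \<le> 2 * r * (x \<bullet> x)" using r by (simp add: mult_left_mono)
  then show ?thesis using r by (simp add: qform_spiked[OF S a(1) b(1) x] abs_mult mult.assoc)
qed

text \<open>
  Inversion reverses the order of positive definite forms.  With \<open>u = C0 x\<close> and \<open>w = C1 x\<close>, the
  Cauchy-Schwarz inequality for the form \<open>S1\<close> bounds \<open>(u \<bullet> S1 w)\<^sup>2 = (qform C0 x)\<^sup>2\<close> by
  \<open>qform S1 u \<cdot> qform C1 x\<close>.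
\<close>

lemma inverse_qform_antimono:
  assumes S0: "pos_def n S0" and S1: "pos_def n S1"
    and C0: "C0 \<in> carrier_mat n n" "S0 * C0 = 1\<^sub>m n" and C1: "C1 \<in> carrier_mat n n" "S1 * C1 = 1\<^sub>m n"
    and le: "\<And>x. x \<in> carrier_vec n \<Longrightarrow> qform S1 x \<le> t * qform S0 x"
    and x: "x \<in> carrier_vec n" and pos: "qform C0 x > 0"
  shows "qform C0 x \<le> t * qform C1 x"
proof -
  have Sc: "S0 \<in> carrier_mat n n" "S1 \<in> carrier_mat n n" "transpose_mat S1 = S1" using S0 S1 by (auto simp: pos_def_def)
  have psd: "qform S1 y \<ge> 0" if "y \<in> carrier_vec n" for y
    using S1 that Sc by (cases "y = 0\<^sub>v n") (auto simp: pos_def_def less_imp_le)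
  define u where "u = C0 *\<^sub>v x"
  define w where "w = C1 *\<^sub>v x"
  have uw: "u \<in> carrier_vec n" "w \<in> carrier_vec n" using C0 C1 x by (auto simp: u_def w_def)
  have Su: "S0 *\<^sub>v u = x" unfolding u_def using C0 Sc x by (metis assoc_mult_mat_vec one_mult_mat_vec)
  have Sw: "S1 *\<^sub>v w = x" unfolding w_def using C1 Sc x by (metis assoc_mult_mat_vec one_mult_mat_vec)
  have q0: "qform C0 x = u \<bullet> x" and q1: "qform C1 x = w \<bullet> x"
    using uw x by (auto simp: u_def w_def comm_scalar_prod[of x n])
  have "(u \<bullet> x)\<^sup>2 \<le> qform S1 u * (w \<bullet> x)"
    using psd_cauchy_schwarz[OF Sc(2,3) psd uw] Sw by simp
  also have "\<dots> \<le> t * (u \<bullet> x) * (w \<bullet> x)"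
    using le[OF uw(1)] psd[OF uw(2)] Sw Su by (intro mult_right_mono) auto
  finally show ?thesis using pos unfolding q0 q1 by (simp add: power2_eq_square mult.assoc mult.left_commute)
qed

text \<open>
  Gives access to the determinant of \<open>Q = S1\<^sup>-\<^sup>1 + S2\<^sup>-\<^sup>1 - S0\<^sup>-\<^sup>1\<close>: writing
  \<open>Si = S0 + Di\<close>, the product \<open>S1 Q S2 = S1 + S2 - S1 S0\<^sup>-\<^sup>1 S2\<close> equals \<open>S0 - D1 S0\<^sup>-\<^sup>1 D2\<close>, and by
  orthogonality \<open>D1 S0\<^sup>-\<^sup>1 D2\<close> is \<open>r\<^sup>2\<close> times \<open>(b1 \<bullet> S0\<^sup>-\<^sup>1 b2) a1 a2\<^sup>T + (a1 \<bullet> S0\<^sup>-\<^sup>1 a2) b1 b2\<^sup>T\<close>, so that the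
  product factors into \<open>S0\<close> and two rank-one updates of the identity.
\<close>

lemma spiked_inverse_identity:
  assumes S0: "S0 \<in> carrier_mat n n" and C0: "C0 \<in> carrier_mat n n" "S0 * C0 = 1\<^sub>m n" "C0 * S0 = 1\<^sub>m n"
    and ab: "a1 \<in> carrier_vec n" "b1 \<in> carrier_vec n" "a2 \<in> carrier_vec n" "b2 \<in> carrier_vec n"
    and orth: "b1 \<bullet> (C0 *\<^sub>v a2) = 0" "a1 \<bullet> (C0 *\<^sub>v b2) = 0" "a2 \<bullet> (C0 *\<^sub>v b1) = 0"
    and C1: "C1 \<in> carrier_mat n n" "spiked n S0 r a1 b1 * C1 = 1\<^sub>m n"
    and C2: "C2 \<in> carrier_mat n n" "C2 * spiked n S0 r a2 b2 = 1\<^sub>m n"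
  shows "spiked n S0 r a1 b1 * (C1 + C2 - C0) * spiked n S0 r a2 b2
     = S0 * (1\<^sub>m n - outer n ((r\<^sup>2 * (b1 \<bullet> (C0 *\<^sub>v b2))) \<cdot>\<^sub>v (C0 *\<^sub>v a1)) a2)
          * (1\<^sub>m n - outer n ((r\<^sup>2 * (a1 \<bullet> (C0 *\<^sub>v a2))) \<cdot>\<^sub>v (C0 *\<^sub>v b1)) b2)"
    (is "?S1 * ?Q * ?S2 = S0 * (1\<^sub>m n - ?A) * (1\<^sub>m n - ?B)")
proof (rule mat_eq_by_vectors)
  have Q: "?Q \<in> carrier_mat n n" using C0(1) by (rule minus_carrier_mat)
  have car: "?S1 \<in> carrier_mat n n" "?S2 \<in> carrier_mat n n" "?A \<in> carrier_mat n n" "?B \<in> carrier_mat n n"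
    by simp_all
  have m: "1\<^sub>m n - ?A \<in> carrier_mat n n" "1\<^sub>m n - ?B \<in> carrier_mat n n"
    using car(3,4) by (auto intro: minus_carrier_mat)
  show "?S1 * ?Q * ?S2 \<in> carrier_mat n n" "S0 * (1\<^sub>m n - ?A) * (1\<^sub>m n - ?B) \<in> carrier_mat n n"
    by (intro mult_carrier_mat[OF mult_carrier_mat[OF car(1) Q] car(2)] mult_carrier_mat[OF mult_carrier_mat[OF S0 m(1)] m(2)])+
  fix x :: "real vec" assume x: "x \<in> carrier_vec n"
  define ca where "ca = C0 *\<^sub>v a1"
  define cb where "cb = C0 *\<^sub>v b1"
  define k1 where "k1 = r\<^sup>2 * (b1 \<bullet> (C0 *\<^sub>v b2)) * (a2 \<bullet> x)"
  define k2 where "k2 = r\<^sup>2 * (a1 \<bullet> (C0 *\<^sub>v a2)) * (b2 \<bullet> x)"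
  have cc: "ca \<in> carrier_vec n" "cb \<in> carrier_vec n" "C0 *\<^sub>v a2 \<in> carrier_vec n" "C0 *\<^sub>v b2 \<in> carrier_vec n"
    using C0 ab by (auto simp: ca_def cb_def)
  define z where "z = (r * (b2 \<bullet> x)) \<cdot>\<^sub>v (C0 *\<^sub>v a2) + (r * (a2 \<bullet> x)) \<cdot>\<^sub>v (C0 *\<^sub>v b2)"
  have z: "z \<in> carrier_vec n" using cc by (simp add: z_def)
  have S0C: "S0 *\<^sub>v (C0 *\<^sub>v y) = y" if "y \<in> carrier_vec n" for y
    using S0 C0 that by (metis assoc_mult_mat_vec one_mult_mat_vec)
  have C0S: "C0 *\<^sub>v (S0 *\<^sub>v y) = y" if "y \<in> carrier_vec n" for y
    using S0 C0 that by (metis assoc_mult_mat_vec one_mult_mat_vec)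
  have S1C: "?S1 *\<^sub>v (C1 *\<^sub>v y) = y" if "y \<in> carrier_vec n" for y
    using car C1 that by (metis assoc_mult_mat_vec one_mult_mat_vec)
  have C2S: "C2 *\<^sub>v (?S2 *\<^sub>v y) = y" if "y \<in> carrier_vec n" for y
    using car C2 that by (metis assoc_mult_mat_vec one_mult_mat_vec)
  have S2x: "?S2 *\<^sub>v x = S0 *\<^sub>v x + ((r * (b2 \<bullet> x)) \<cdot>\<^sub>v a2 + (r * (a2 \<bullet> x)) \<cdot>\<^sub>v b2)"
    by (rule spiked_mult_vec[OF S0 ab(3,4) x])
  have S0x: "S0 *\<^sub>v x \<in> carrier_vec n" using S0 x by simp
  have C0S2x: "C0 *\<^sub>v (?S2 *\<^sub>v x) = x + z"
    unfolding S2x z_def using ab x C0 S0x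
    by (simp add: mult_add_distrib_mat_vec[of C0 n n] mult_mat_vec[of C0 n n] C0S)
  have S0z: "S0 *\<^sub>v z = (r * (b2 \<bullet> x)) \<cdot>\<^sub>v a2 + (r * (a2 \<bullet> x)) \<cdot>\<^sub>v b2"
    unfolding z_def using ab S0 cc
    by (simp add: mult_add_distrib_mat_vec[of S0 n n] mult_mat_vec[of S0 n n] S0C)
  have b1z: "r * (b1 \<bullet> z) = k1" "r * (a1 \<bullet> z) = k2"
    unfolding z_def k1_def k2_def using ab cc orth
    by (simp_all add: scalar_prod_add_distrib[of _ n] power2_eq_square)
  have S1z: "?S1 *\<^sub>v z = S0 *\<^sub>v z + (k1 \<cdot>\<^sub>v a1 + k2 \<cdot>\<^sub>v b1)"
    using spiked_mult_vec[OF S0 ab(1,2) z, of r] unfolding b1z .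
  have S2xc: "?S2 *\<^sub>v x \<in> carrier_vec n" "?S1 *\<^sub>v x \<in> carrier_vec n" "?S1 *\<^sub>v z \<in> carrier_vec n" 
    using mult_mat_vec_carrier[OF car(2) x] mult_mat_vec_carrier[OF car(1) x] mult_mat_vec_carrier[OF car(1) z] .
  have "(?S1 * ?Q * ?S2) *\<^sub>v x = ?S1 *\<^sub>v (?Q *\<^sub>v (?S2 *\<^sub>v x))"
    unfolding assoc_mult_mat_vec[OF mult_carrier_mat[OF car(1) Q] car(2) x] assoc_mult_mat_vec[OF car(1) Q S2xc(1)] ..
  also have "?Q *\<^sub>v (?S2 *\<^sub>v x) = C1 *\<^sub>v (?S2 *\<^sub>v x) + x - (x + z)"
    using C0 C1 C2 S2xc x
    by (simp add: minus_mult_distrib_mat_vec[of _ n n] add_mult_distrib_mat_vec[of _ n n] C2S C0S2x)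
  also have "\<dots> = C1 *\<^sub>v (?S2 *\<^sub>v x) - z"
    using C1 S2xc x z by (intro eq_vecI) auto
  also have "?S1 *\<^sub>v (C1 *\<^sub>v (?S2 *\<^sub>v x) - z) = ?S2 *\<^sub>v x - ?S1 *\<^sub>v z"
    using C1 S2xc z car by (simp add: mult_minus_distrib_mat_vec[of _ n n] S1C)
  also have "\<dots> = S0 *\<^sub>v x - (k1 \<cdot>\<^sub>v a1 + k2 \<cdot>\<^sub>v b1)"
    unfolding S1z S0z S2x using S0x ab by (intro eq_vecI) auto
  finally have L: "(?S1 * ?Q * ?S2) *\<^sub>v x = S0 *\<^sub>v x - (k1 \<cdot>\<^sub>v a1 + k2 \<cdot>\<^sub>v b1)" .
  have Bx: "(1\<^sub>m n - ?B) *\<^sub>v x = x - k2 \<cdot>\<^sub>v cb"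
    using x ab cc unfolding cb_def[symmetric]
    by (simp add: minus_mult_distrib_mat_vec[of _ n n] outer_mult_vec k2_def smult_smult_assoc mult_ac)
  have xc: "x - k2 \<cdot>\<^sub>v cb \<in> carrier_vec n" using x cc by simp
  have "(1\<^sub>m n - ?A) *\<^sub>v (x - k2 \<cdot>\<^sub>v cb) = (x - k2 \<cdot>\<^sub>v cb) - ((r\<^sup>2 * (b1 \<bullet> (C0 *\<^sub>v b2))) * (a2 \<bullet> (x - k2 \<cdot>\<^sub>v cb))) \<cdot>\<^sub>v ca"
    using xc ab cc unfolding ca_def[symmetric]
    by (simp add: minus_mult_distrib_mat_vec[of _ n n] outer_mult_vec smult_smult_assoc mult_ac)
  also have "a2 \<bullet> (x - k2 \<cdot>\<^sub>v cb) = a2 \<bullet> x"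
    using x ab cc orth(3) unfolding cb_def[symmetric] by (simp add: scalar_prod_minus_distrib[of _ n])
  finally have Ax: "(1\<^sub>m n - ?A) *\<^sub>v (x - k2 \<cdot>\<^sub>v cb) = (x - k2 \<cdot>\<^sub>v cb) - k1 \<cdot>\<^sub>v ca"
    by (simp add: k1_def)
  have "(S0 * (1\<^sub>m n - ?A) * (1\<^sub>m n - ?B)) *\<^sub>v x = S0 *\<^sub>v ((1\<^sub>m n - ?A) *\<^sub>v ((1\<^sub>m n - ?B) *\<^sub>v x))"
  proof -
    have "(1\<^sub>m n - ?B) *\<^sub>v x \<in> carrier_vec n" using m(2) x by (rule mult_mat_vec_carrier)
    then show ?thesis using m S0 x by (simp only: assoc_mult_mat_vec[of _ n n _ n] mult_carrier_mat[of _ n n _ n])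
  qed
  also have "\<dots> = S0 *\<^sub>v ((x - k2 \<cdot>\<^sub>v cb) - k1 \<cdot>\<^sub>v ca)" unfolding Bx Ax ..
  also have "\<dots> = (S0 *\<^sub>v x - k2 \<cdot>\<^sub>v b1) - k1 \<cdot>\<^sub>v a1"
    using S0 x cc ab by (simp add: mult_minus_distrib_mat_vec[of _ n n] mult_mat_vec[of _ n n] ca_def cb_def S0C)
  also have "\<dots> = S0 *\<^sub>v x - (k1 \<cdot>\<^sub>v a1 + k2 \<cdot>\<^sub>v b1)" using S0x ab by (intro eq_vecI) auto
  finally show "(?S1 * ?Q * ?S2) *\<^sub>v x = (S0 * (1\<^sub>m n - ?A) * (1\<^sub>m n - ?B)) *\<^sub>v x" using L by simp
qed

lemma pos_def_spiked:
  assumes S0: "S0 \<in> carrier_mat n n" "transpose_mat S0 = S0"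
    and lower: "\<And>x. x \<in> carrier_vec n \<Longrightarrow> m * (x \<bullet> x) \<le> qform S0 x"
    and a: "a \<in> carrier_vec n" "a \<bullet> a = 1" and b: "b \<in> carrier_vec n" "b \<bullet> b = 1"
    and r: "0 \<le> r" "2 * r < m"
  shows "pos_def n (spiked n S0 r a b)"
  unfolding pos_def_def
proof (intro conjI ballI impI spiked_carrier spiked_symmetric[OF S0])
  fix x :: "real vec" assume x: "x \<in> carrier_vec n" "x \<noteq> 0\<^sub>v n"
  have "2 * r * (x \<bullet> x) < m * (x \<bullet> x)" using vec_norm_pos[OF x] r by simp
  then show "qform (spiked n S0 r a b) x > 0"
    using qform_spiked_bound[OF S0(1) a b x(1) r(1)] lower[OF x(1)] by linarith
qed

text \<open>
  The integrand is a constant times \<open>exp (- qform Q x / 2)\<close> with \<open>Q = C1 + C2 - C0\<close>, so the integral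
  is \<open>sqrt (det S0 / (det S1 det Q det S2))\<close>, and \<open>spiked_inverse_identity\<close> shows that the
  quotient of determinants is the square of the asserted value.  The integral converges since \<open>2 r < m\<close> makes each \<open>Si\<close> less than
  twice \<open>S0\<close>, whence each \<open>Ci\<close> is more than half of \<open>C0\<close> and \<open>Q\<close> is positive definite.
\<close>

proposition spiked_cross_moment:
  assumes S0: "S0 \<in> carrier_mat n n" "transpose_mat S0 = S0"
    and lower: "\<And>x. x \<in> carrier_vec n \<Longrightarrow> m * (x \<bullet> x) \<le> qform S0 x"
    and a1: "a1 \<in> carrier_vec n" "a1 \<bullet> a1 = 1" and b1: "b1 \<in> carrier_vec n" "b1 \<bullet> b1 = 1"
    and a2: "a2 \<in> carrier_vec n" "a2 \<bullet> a2 = 1" and b2: "b2 \<in> carrier_vec n" "b2 \<bullet> b2 = 1"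
    and r: "0 \<le> r" "2 * r < m"
    and C0: "mat_inverse S0 = Some C0"
    and orth: "b1 \<bullet> (C0 *\<^sub>v a2) = 0" "a1 \<bullet> (C0 *\<^sub>v b2) = 0"
    and small: "r\<^sup>2 * (a1 \<bullet> (C0 *\<^sub>v a2)) * (b1 \<bullet> (C0 *\<^sub>v b2)) < 1"
  shows "(\<integral>\<^sup>+ x. ennreal (mvn_density n (spiked n S0 r a1 b1) x * mvn_density n (spiked n S0 r a2 b2) x / mvn_density n S0 x)
             \<partial>PiM {..<n} (\<lambda>_. lborel))
         = ennreal (1 / (1 - r\<^sup>2 * (a1 \<bullet> (C0 *\<^sub>v a2)) * (b1 \<bullet> (C0 *\<^sub>v b2))))"
proof -
  define S1 where "S1 = spiked n S0 r a1 b1"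
  define S2 where "S2 = spiked n S0 r a2 b2"
  define c where "c = r\<^sup>2 * (a1 \<bullet> (C0 *\<^sub>v a2)) * (b1 \<bullet> (C0 *\<^sub>v b2))"
  have c: "c < 1" using small by (simp add: c_def)
  have m: "m > 0" using r by linarith
  have p0: "pos_def n S0" unfolding pos_def_def
    using S0 lower vec_norm_pos m by (meson less_le_trans mult_pos_pos)
  have p1: "pos_def n S1" unfolding S1_def by (rule pos_def_spiked[OF S0 lower a1 b1 r])
  have p2: "pos_def n S2" unfolding S2_def by (rule pos_def_spiked[OF S0 lower a2 b2 r])
  have C0': "pos_def n C0" "S0 * C0 = 1\<^sub>m n" "C0 * S0 = 1\<^sub>m n" "det C0 = 1 / det S0"
    using pos_def_invertible[OF p0] C0 by (metis option.inject)+
  obtain C1 where C1: "mat_inverse S1 = Some C1" "pos_def n C1" "S1 * C1 = 1\<^sub>m n" "C1 * S1 = 1\<^sub>m n"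
    using pos_def_invertible[OF p1] by metis
  obtain C2 where C2: "mat_inverse S2 = Some C2" "pos_def n C2" "S2 * C2 = 1\<^sub>m n" "C2 * S2 = 1\<^sub>m n"
    using pos_def_invertible[OF p2] by metis
  have Cc: "C0 \<in> carrier_mat n n" "C1 \<in> carrier_mat n n" "C2 \<in> carrier_mat n n" using C0' C1 C2 by (auto simp: pos_def_def)
  have Ct: "transpose_mat C0 = C0" "transpose_mat C1 = C1" "transpose_mat C2 = C2" using C0' C1 C2 by (auto simp: pos_def_def)
  have Sc: "S1 \<in> carrier_mat n n" "S2 \<in> carrier_mat n n" by (auto simp: S1_def S2_def)
  define Q where "Q = C1 + C2 - C0"
  have Qc: "Q \<in> carrier_mat n n" unfolding Q_def using Cc(1) by (rule minus_carrier_mat)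
  have qQ: "qform Q x = qform C1 x + qform C2 x - qform C0 x" if x: "x \<in> carrier_vec n" for x
    unfolding Q_def using Cc x
    by (simp add: minus_mult_distrib_mat_vec[of _ n n] add_mult_distrib_mat_vec[of _ n n]
        scalar_prod_add_distrib[of _ n] scalar_prod_minus_distrib[of _ n])
  have dominated: "qform (spiked n S0 r a b) x \<le> (1 + 2 * r / m) * qform S0 x"
    if "a \<in> carrier_vec n" "a \<bullet> a = 1" "b \<in> carrier_vec n" "b \<bullet> b = 1" "x \<in> carrier_vec n" for a b x
  proof -
    have "2 * r * (x \<bullet> x) \<le> 2 * r / m * qform S0 x"
      using mult_left_mono[OF lower[OF that(5)], of "2 * r / m"] m r by simp
    then show ?thesis using qform_spiked_bound[OF S0(1) that r(1)] by (simp add: distrib_right)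
  qed
  have pQ: "pos_def n Q" unfolding pos_def_def
  proof (intro conjI ballI impI Qc)
    show "transpose_mat Q = Q" unfolding Q_def using Cc Ct
      by (simp add: transpose_minus[of _ n n] transpose_add[of _ n n])
    fix x :: "real vec" assume x: "x \<in> carrier_vec n" "x \<noteq> 0\<^sub>v n"
    have q0: "qform C0 x > 0" using C0'(1) x by (simp add: pos_def_def)
    define t where "t = 1 + 2 * r / m"
    have t: "t > 0" "t < 2" using r m by (auto simp: t_def add_pos_nonneg)
    have "qform C0 x \<le> t * qform C1 x"
      by (rule inverse_qform_antimono[OF p0 p1 Cc(1) C0'(2) Cc(2) C1(3) _ x(1) q0])
        (use dominated[OF a1 b1] in \<open>simp add: S1_def t_def\<close>)
    moreover have "qform C0 x \<le> t * qform C2 x"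
      by (rule inverse_qform_antimono[OF p0 p2 Cc(1) C0'(2) Cc(3) C2(3) _ x(1) q0])
        (use dominated[OF a2 b2] in \<open>simp add: S2_def t_def\<close>)
    \<comment> \<open>Adding up, \<open>C1 + C2\<close> dominates \<open>(2 / t) C0\<close>, and \<open>2 / t > 1\<close>.\<close>
    ultimately have "2 * qform C0 x \<le> t * (qform C1 x + qform C2 x)" by (simp add: distrib_left)
    moreover have "t * qform C0 x < 2 * qform C0 x" using t q0 by simp
    ultimately have "t * qform C0 x < t * (qform C1 x + qform C2 x)" by linarith
    then show "qform Q x > 0" using t by (simp add: qQ[OF x(1)])
  qed
  have orth3: "a2 \<bullet> (C0 *\<^sub>v b1) = 0"
    using orth(1) symmetric_bilinear[OF Cc(1) Ct(1) a2(1) b1(1)] by simp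
  have id: "S1 * Q * S2 = S0 * (1\<^sub>m n - outer n ((r\<^sup>2 * (b1 \<bullet> (C0 *\<^sub>v b2))) \<cdot>\<^sub>v (C0 *\<^sub>v a1)) a2)
          * (1\<^sub>m n - outer n ((r\<^sup>2 * (a1 \<bullet> (C0 *\<^sub>v a2))) \<cdot>\<^sub>v (C0 *\<^sub>v b1)) b2)" (is "_ = S0 * ?A * ?B")
    unfolding S1_def S2_def Q_def
    by (rule spiked_inverse_identity[OF S0(1) Cc(1) C0'(2,3) a1(1) b1(1) a2(1) b2(1) orth orth3 Cc(2) C1(3)[unfolded S1_def] Cc(3) C2(4)[unfolded S2_def]])
  have AB: "?A \<in> carrier_mat n n" "?B \<in> carrier_mat n n" by (auto intro: minus_carrier_mat[OF outer_carrier])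
  have "det S1 * det Q * det S2 = det S0 * det ?A * det ?B"
    using arg_cong[OF id, of det] Sc Qc S0 AB
    by (simp add: det_mult[of _ n] mult_carrier_mat[of _ n n _ n])
  also have "det ?A = 1 - c"
    using a1 a2 Cc by (subst det_one_minus_outer) (auto simp: c_def symmetric_bilinear[OF Cc(1) Ct(1) a2(1) a1(1)])
  also have "det ?B = 1 - c"
    using b1 b2 Cc by (subst det_one_minus_outer) (auto simp: c_def symmetric_bilinear[OF Cc(1) Ct(1) b2(1) b1(1)])
  finally have dets: "det S1 * det Q * det S2 = det S0 * (1 - c)\<^sup>2" by (simp add: power2_eq_square)
  have d: "det S0 > 0" "det S1 > 0" "det S2 > 0" "det Q > 0"
    using gaussian_integral[OF p0] gaussian_integral[OF p1] gaussian_integral[OF p2] gaussian_integral[OF pQ] by auto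
  define P where "P = (2 * pi) ^ n"
  have P: "P > 0" by (simp add: P_def)
  define K where "K = sqrt (P * det S0) / (sqrt (P * det S1) * sqrt (P * det S2))"
  have K: "K > 0" using d P by (simp add: K_def)
  have dens: "mvn_density n S1 x * mvn_density n S2 x / mvn_density n S0 x = K * exp (- qform Q (vec n x) / 2)" for x
  proof -
    have "exp (- (q1 + q2 - q0) / 2) = exp (- q1 / 2) * exp (- q2 / 2) / exp (- q0 / 2)" for q0 q1 q2 :: real
      by (simp add: exp_add[symmetric] exp_diff[symmetric] diff_divide_distrib add_divide_distrib)
    then show ?thesis
      unfolding mvn_density_eq[OF C0] mvn_density_eq[OF C1(1)] mvn_density_eq[OF C2(1)] K_def P_def[symmetric]
        qQ[OF vec_carrier] by simp
  qed
  have "(\<integral>\<^sup>+ x. ennreal (mvn_density n S1 x * mvn_density n S2 x / mvn_density n S0 x) \<partial>PiM {..<n} (\<lambda>_. lborel))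
      = (\<integral>\<^sup>+ x. ennreal K * ennreal (exp (- qform Q (vec n x) / 2)) \<partial>PiM {..<n} (\<lambda>_. lborel))"
    unfolding dens using K by (simp add: ennreal_mult)
  also have "\<dots> = ennreal K * ennreal (sqrt (P / det Q))"
    using gaussian_integral[OF pQ] unfolding P_def by (simp only: nn_integral_cmult[OF gaussian_kernel_measurable[OF Qc]])
  also have "\<dots> = ennreal (K * sqrt (P / det Q))" using K P d by (simp add: ennreal_mult)
  also have "K * sqrt (P / det Q) = 1 / (1 - c)"
  proof -
    have "K * sqrt (P / det Q) = sqrt ((P * det S0) / ((P * det S1) * (P * det S2)) * (P / det Q))"
      unfolding K_def by (simp only: real_sqrt_mult real_sqrt_divide)
    also have "(P * det S0) / ((P * det S1) * (P * det S2)) * (P / det Q) = det S0 / (det S1 * det Q * det S2)"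
      using P by (simp add: field_simps)
    also have "\<dots> = (1 / (1 - c))\<^sup>2" unfolding dets using d by (simp add: power_divide)
    finally show ?thesis using c by simp
  qed
  finally show ?thesis unfolding S1_def S2_def c_def .
qed

section \<open>Likelihoods of samples and the second moment method\<close>

text \<open>
  Both sides agree on boxes, where the integral of the product of densities factorises.
\<close>

lemma PiM_density_const:
  fixes N :: "'a measure" and f :: "'a \<Rightarrow> ennreal"
  assumes I: "finite I" and N: "sigma_finite_measure N" and D: "sigma_finite_measure (density N f)"
    and f [measurable]: "f \<in> borel_measurable N"
  shows "PiM I (\<lambda>_. density N f) = density (PiM I (\<lambda>_. N)) (\<lambda>\<omega>. \<Prod>i\<in>I. f (\<omega> i))"
proof -
  interpret N: product_sigma_finite "\<lambda>_. N" using N by (simp add: product_sigma_finite_def)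
  interpret D: product_sigma_finite "\<lambda>_. density N f" using D by (simp add: product_sigma_finite_def)
  have "density (PiM I (\<lambda>_. N)) (\<lambda>\<omega>. \<Prod>i\<in>I. f (\<omega> i)) = PiM I (\<lambda>_. density N f)"
  proof (rule D.PiM_eqI[OF I])
    show "sets (density (PiM I (\<lambda>_. N)) (\<lambda>\<omega>. \<Prod>i\<in>I. f (\<omega> i))) = sets (PiM I (\<lambda>_. density N f))"
      by (simp cong: sets_PiM_cong)
    fix A assume "\<And>i. i \<in> I \<Longrightarrow> A i \<in> sets (density N f)"
    then have A [measurable]: "\<And>i. i \<in> I \<Longrightarrow> A i \<in> sets N" by simp
    have prod: "(\<lambda>\<omega>. \<Prod>i\<in>I. f (\<omega> i)) \<in> borel_measurable (PiM I (\<lambda>_. N))" by measurable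
    have "emeasure (density (PiM I (\<lambda>_. N)) (\<lambda>\<omega>. \<Prod>i\<in>I. f (\<omega> i))) (Pi\<^sub>E I A)
        = (\<integral>\<^sup>+ \<omega>. (\<Prod>i\<in>I. f (\<omega> i)) * indicator (Pi\<^sub>E I A) \<omega> \<partial>PiM I (\<lambda>_. N))"
      by (rule emeasure_density[OF prod]) (rule sets_PiM_I_finite[OF I A])
    also have "\<dots> = (\<integral>\<^sup>+ \<omega>. (\<Prod>i\<in>I. f (\<omega> i) * indicator (A i) (\<omega> i)) \<partial>PiM I (\<lambda>_. N))"
    proof (rule nn_integral_cong)
      fix \<omega> assume "\<omega> \<in> space (PiM I (\<lambda>_. N))"
      then have ext: "\<omega> \<in> extensional I" by (auto simp: space_PiM PiE_def)
      have "indicator (Pi\<^sub>E I A) \<omega> = (\<Prod>i\<in>I. indicator (A i) (\<omega> i) :: ennreal)"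
      proof (cases "\<forall>i\<in>I. \<omega> i \<in> A i")
        case True
        then show ?thesis using ext by (simp add: PiE_def)
      next
        case False
        then obtain i where i: "i \<in> I" "\<omega> i \<notin> A i" by auto
        then have "(\<Prod>i\<in>I. indicator (A i) (\<omega> i) :: ennreal) = 0" using I by (intro prod_zero) (auto intro!: bexI[of _ i])
        moreover have "\<omega> \<notin> Pi\<^sub>E I A" using i by (auto simp: PiE_def)
        ultimately show ?thesis by simp
      qed
      then show "(\<Prod>i\<in>I. f (\<omega> i)) * indicator (Pi\<^sub>E I A) \<omega> = (\<Prod>i\<in>I. f (\<omega> i) * indicator (A i) (\<omega> i))"
        by (simp add: prod.distrib)
    qed
    also have "\<dots> = (\<Prod>i\<in>I. \<integral>\<^sup>+ x. f x * indicator (A i) x \<partial>N)"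
      by (rule N.product_nn_integral_prod[OF I]) measurable
    also have "\<dots> = (\<Prod>i\<in>I. emeasure (density N f) (A i))"
      by (intro prod.cong refl emeasure_density[symmetric]) (use A in auto)
    finally show "emeasure (density (PiM I (\<lambda>_. N)) (\<lambda>\<omega>. \<Prod>i\<in>I. f (\<omega> i))) (Pi\<^sub>E I A) = (\<Prod>i\<in>I. emeasure (density N f) (A i))" .
  qed
  then show ?thesis by simp
qed

abbreviation euclid :: "nat \<Rightarrow> (nat \<Rightarrow> real) measure" where
  "euclid d \<equiv> PiM {..<d} (\<lambda>_. lborel)"

abbreviation samples :: "nat \<Rightarrow> nat \<Rightarrow> (nat \<Rightarrow> nat \<Rightarrow> real) measure" where
  "samples n d \<equiv> PiM {..<n} (\<lambda>_. euclid d)"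

definition likelihood :: "nat \<Rightarrow> nat \<Rightarrow> real mat \<Rightarrow> (nat \<Rightarrow> nat \<Rightarrow> real) \<Rightarrow> real" where
  "likelihood n d S \<omega> = (\<Prod>i<n. mvn_density d S (\<omega> i))"

lemma sigma_finite_euclid: "sigma_finite_measure (euclid d)"
proof -
  interpret product_sigma_finite "\<lambda>_::nat. lborel :: real measure" ..
  show ?thesis by (rule sigma_finite) simp
qed

lemma likelihood_pos: "pos_def d S \<Longrightarrow> likelihood n d S \<omega> > 0"
  by (simp add: likelihood_def mvn_density_pos prod_pos)

lemma likelihood_measurable:
  assumes "pos_def d S"
  shows "likelihood n d S \<in> borel_measurable (samples n d)"
proof -
  note [measurable] = mvn_density_measurable[OF assms]
  show ?thesis unfolding likelihood_def[abs_def] by measurable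
qed

lemma sample_law_eq_density:
  assumes S: "pos_def d S"
  shows "sample_law n d S = density (samples n d) (\<lambda>\<omega>. ennreal (likelihood n d S \<omega>))"
proof -
  note [measurable] = mvn_density_measurable[OF S]
  have "emeasure (mvn d S) (space (mvn d S)) = 1"
    by (simp add: mvn_def emeasure_density nn_integral_mvn_density[OF S] cong: nn_integral_cong)
  then have "prob_space (mvn d S)" by (rule prob_spaceI)
  then have "sigma_finite_measure (density (euclid d) (\<lambda>x. ennreal (mvn_density d S x)))"
    unfolding mvn_def using prob_space_imp_sigma_finite by blast
  then have "PiM {..<n} (\<lambda>_. density (euclid d) (\<lambda>x. ennreal (mvn_density d S x)))
      = density (samples n d) (\<lambda>\<omega>. \<Prod>i<n. ennreal (mvn_density d S (\<omega> i)))"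
    by (intro PiM_density_const sigma_finite_euclid) auto
  then show ?thesis
    by (simp add: sample_law_def mvn_def likelihood_def prod_ennreal less_imp_le[OF mvn_density_pos[OF S]])
qed

lemma nn_integral_product_power:
  assumes g: "g \<in> borel_measurable (euclid d)" and g0: "\<And>x. g x \<ge> 0"
  shows "(\<integral>\<^sup>+ \<omega>. ennreal (\<Prod>i<n. g (\<omega> i)) \<partial>samples n d) = (\<integral>\<^sup>+ x. ennreal (g x) \<partial>euclid d) ^ n"
proof -
  interpret product_sigma_finite "\<lambda>_::nat. euclid d" using sigma_finite_euclid by (simp add: product_sigma_finite_def)
  have "(\<integral>\<^sup>+ \<omega>. ennreal (\<Prod>i<n. g (\<omega> i)) \<partial>samples n d) = (\<integral>\<^sup>+ \<omega>. (\<Prod>i<n. ennreal (g (\<omega> i))) \<partial>samples n d)"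
    by (simp add: prod_ennreal g0)
  also have "\<dots> = (\<Prod>i<n. \<integral>\<^sup>+ x. ennreal (g x) \<partial>euclid d)"
    by (rule product_nn_integral_prod) (use g in auto)
  finally show ?thesis by simp
qed

lemma has_bochner_integral_likelihood:
  assumes S: "pos_def d S"
  shows "has_bochner_integral (samples n d) (likelihood n d S) 1"
proof (rule has_bochner_integral_nn_integral)
  show "(\<integral>\<^sup>+ \<omega>. ennreal (likelihood n d S \<omega>) \<partial>samples n d) = ennreal 1"
    unfolding likelihood_def using mvn_density_pos[OF S]
    by (subst nn_integral_product_power) (auto simp: nn_integral_mvn_density[OF S] mvn_density_measurable[OF S] less_imp_le)
qed (use likelihood_pos[OF S] likelihood_measurable[OF S] in \<open>auto simp: less_imp_le\<close>)

lemma has_bochner_integral_likelihood_cross: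
  assumes S: "pos_def d S0" "pos_def d S1" "pos_def d S2"
    and I: "(\<integral>\<^sup>+ x. ennreal (mvn_density d S1 x * mvn_density d S2 x / mvn_density d S0 x) \<partial>euclid d) = ennreal c"
    and c: "c \<ge> 0"
  shows "has_bochner_integral (samples n d)
    (\<lambda>\<omega>. likelihood n d S1 \<omega> * likelihood n d S2 \<omega> / likelihood n d S0 \<omega>) (c ^ n)"
proof (rule has_bochner_integral_nn_integral)
  note [measurable] = likelihood_measurable[OF S(1)] likelihood_measurable[OF S(2)] likelihood_measurable[OF S(3)]
    mvn_density_measurable[OF S(1)] mvn_density_measurable[OF S(2)] mvn_density_measurable[OF S(3)]
  show "(\<lambda>\<omega>. likelihood n d S1 \<omega> * likelihood n d S2 \<omega> / likelihood n d S0 \<omega>) \<in> borel_measurable (samples n d)"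
    by measurable
  show "AE \<omega> in samples n d. 0 \<le> likelihood n d S1 \<omega> * likelihood n d S2 \<omega> / likelihood n d S0 \<omega>"
    using likelihood_pos[OF S(1)] likelihood_pos[OF S(2)] likelihood_pos[OF S(3)] by (simp add: less_imp_le)
  have "(\<integral>\<^sup>+ \<omega>. ennreal (likelihood n d S1 \<omega> * likelihood n d S2 \<omega> / likelihood n d S0 \<omega>) \<partial>samples n d)
      = (\<integral>\<^sup>+ \<omega>. ennreal (\<Prod>i<n. mvn_density d S1 (\<omega> i) * mvn_density d S2 (\<omega> i) / mvn_density d S0 (\<omega> i)) \<partial>samples n d)"
    by (simp add: likelihood_def prod.distrib prod_dividef)
  also have "\<dots> = ennreal c ^ n" unfolding I[symmetric]
    using mvn_density_pos[OF S(1)] mvn_density_pos[OF S(2)] mvn_density_pos[OF S(3)]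
    by (intro nn_integral_product_power) (auto simp: less_imp_le)
  finally show "(\<integral>\<^sup>+ \<omega>. ennreal (likelihood n d S1 \<omega> * likelihood n d S2 \<omega> / likelihood n d S0 \<omega>) \<partial>samples n d) = ennreal (c ^ n)"
    using c by (simp add: ennreal_power)
qed (use c in simp)

text \<open>
  Tests are defined over Borel coordinates and likelihoods over Lebesgue-Borel ones; the underlying
  measurable spaces coincide.
\<close>

lemma tests_measurable:
  assumes "\<psi> \<in> tests n d"
  shows "\<psi> \<in> borel_measurable (samples n d)" "\<And>\<omega>. \<omega> \<in> space (samples n d) \<Longrightarrow> 0 \<le> \<psi> \<omega> \<and> \<psi> \<omega> \<le> 1"
proof -
  have s: "sets (PiM {..<n} (\<lambda>_. PiM {..<d} (\<lambda>_. borel :: real measure))) = sets (samples n d)"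
    by (intro sets_PiM_cong refl) simp
  have "space (PiM {..<n} (\<lambda>_. PiM {..<d} (\<lambda>_. borel :: real measure))) = space (samples n d)"
    by (rule sets_eq_imp_space_eq[OF s])
  then show "\<psi> \<in> borel_measurable (samples n d)" "\<And>\<omega>. \<omega> \<in> space (samples n d) \<Longrightarrow> 0 \<le> \<psi> \<omega> \<and> \<psi> \<omega> \<le> 1"
    using assms unfolding tests_def measurable_cong_sets[OF s refl] by auto
qed

lemma testing_risk_eq:
  assumes S: "pos_def d S0" "pos_def d S" and psi: "\<psi> \<in> tests n d"
  shows "testing_risk n d S0 S \<psi> =
    (\<integral>\<omega>. likelihood n d S0 \<omega> * \<psi> \<omega> \<partial>samples n d) + (\<integral>\<omega>. likelihood n d S \<omega> * (1 - \<psi> \<omega>) \<partial>samples n d)"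
proof -
  note [measurable] = likelihood_measurable[OF S(1)] likelihood_measurable[OF S(2)] tests_measurable(1)[OF psi]
  show ?thesis unfolding testing_risk_def sample_law_eq_density[OF S(1)] sample_law_eq_density[OF S(2)]
    using likelihood_pos[OF S(1)] likelihood_pos[OF S(2)]
    by (subst (1 2) integral_density) (auto simp: less_imp_le)
qed

text \<open>
  The right side is at least \<open>min f g\<close>, and the left side is \<open>f\<close> minus half of
  \<open>\<delta> f + (f - g)\<^sup>2 / (\<delta> f)\<close>, and that half is at least \<open>\<bar>f - g\<bar>\<close> by the inequality of arithmetic and
  geometric means.  Unlike \<open>min f g\<close> the left side is linear in \<open>f\<close>, \<open>g\<close> and \<open>g\<^sup>2 / f\<close>, so it can be integrated term by
  term.
\<close>

lemma affinity_pointwise_bound: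
  fixes f g \<psi> \<delta> :: real
  assumes f: "f > 0" and d: "\<delta> > 0" and psi: "0 \<le> \<psi>" "\<psi> \<le> 1"
  shows "(1 - \<delta> / 2 - 1 / (2 * \<delta>)) * f + g / \<delta> - (g * g / f) / (2 * \<delta>) \<le> f * \<psi> + g * (1 - \<psi>)"
proof -
  have eq: "(1 - \<delta> / 2 - 1 / (2 * \<delta>)) * f + g / \<delta> - (g * g / f) / (2 * \<delta>)
      = f - (\<delta> * f + (f - g)\<^sup>2 / (\<delta> * f)) / 2"
    using f d by (simp add: field_simps power2_eq_square)
  have nn: "0 \<le> \<delta> * f + (f - g)\<^sup>2 / (\<delta> * f)" using f d by (intro add_nonneg_nonneg) auto
  have "2 * (\<delta> * f) * (f - g) \<le> (\<delta> * f)\<^sup>2 + (f - g)\<^sup>2" by (rule sum_squares_bound)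
  then have "2 * (f - g) \<le> \<delta> * f + (f - g)\<^sup>2 / (\<delta> * f)"
    using f d by (simp add: field_simps power2_eq_square)
  moreover have "2 * (f - g) \<le> Z \<Longrightarrow> f - Z / 2 \<le> g" "0 \<le> Z \<Longrightarrow> f - Z / 2 \<le> f" for Z
    by simp_all
  ultimately have le: "f - (\<delta> * f + (f - g)\<^sup>2 / (\<delta> * f)) / 2 \<le> g" "f - (\<delta> * f + (f - g)\<^sup>2 / (\<delta> * f)) / 2 \<le> f"
    using nn by blast+
  define L where "L = f - (\<delta> * f + (f - g)\<^sup>2 / (\<delta> * f)) / 2"
  have "L = \<psi> * L + (1 - \<psi>) * L" by (simp add: algebra_simps)
  also have "\<dots> \<le> \<psi> * f + (1 - \<psi>) * g"
    using le psi unfolding L_def[symmetric] by (intro add_mono mult_left_mono) auto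
  finally show ?thesis unfolding eq L_def by (simp add: mult.commute)
qed

text \<open>
  Le Cam's bound for the mixture \<open>G\<close> of the \<open>F t\<close>: integrating the pointwise bound for \<open>F0\<close> and \<open>G\<close>
  gives \<open>1 - \<delta> / 2 - \<chi>\<^sup>2 / (2 \<delta>)\<close>, where \<open>\<chi>\<^sup>2 = \<integral> G\<^sup>2 / F0 - 1 \<le> \<delta>\<^sup>2\<close>.  The risk against \<open>G\<close> is the
  average of the risks against the \<open>F t\<close>, so one of these is as large.
\<close>

lemma second_moment_testing_bound:
  fixes F0 :: "'a \<Rightarrow> real" and F :: "'i \<Rightarrow> 'a \<Rightarrow> real" and J :: "'i \<Rightarrow> 'i \<Rightarrow> real"
  assumes T: "finite T" "T \<noteq> {}" and d: "\<delta> > 0"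
    and F0: "has_bochner_integral \<mu> F0 1" "\<And>x. F0 x > 0"
    and F: "\<And>t. t \<in> T \<Longrightarrow> has_bochner_integral \<mu> (F t) 1" "\<And>t x. t \<in> T \<Longrightarrow> F t x \<ge> 0"
    and J: "\<And>s t. s \<in> T \<Longrightarrow> t \<in> T \<Longrightarrow> has_bochner_integral \<mu> (\<lambda>x. F s x * F t x / F0 x) (J s t)"
    and second_moment: "(\<Sum>s\<in>T. \<Sum>t\<in>T. J s t) \<le> (1 + \<delta>\<^sup>2) * (real (card T))\<^sup>2"
    and psi: "\<psi> \<in> borel_measurable \<mu>" "\<And>x. x \<in> space \<mu> \<Longrightarrow> 0 \<le> \<psi> x \<and> \<psi> x \<le> 1"
  shows "\<exists>t\<in>T. 1 - \<delta> \<le> (\<integral>x. F0 x * \<psi> x \<partial>\<mu>) + (\<integral>x. F t x * (1 - \<psi> x) \<partial>\<mu>)"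
proof (rule ccontr)
  define N where "N = real (card T)"
  have N: "N > 0" using T by (simp add: N_def card_gt_0_iff)
  define G where "G x = (\<Sum>t\<in>T. F t x) / N" for x
  assume "\<not> ?thesis"
  then have less: "(\<integral>x. F0 x * \<psi> x \<partial>\<mu>) + (\<integral>x. F t x * (1 - \<psi> x) \<partial>\<mu>) < 1 - \<delta>" if "t \<in> T" for t
    using that by force
  have int_psi: "integrable \<mu> (\<lambda>x. f x * \<psi> x)" "integrable \<mu> (\<lambda>x. f x * (1 - \<psi> x))" if f: "integrable \<mu> f" for f :: "'a \<Rightarrow> real"
  proof -
    note [measurable] = psi(1) borel_measurable_integrable[OF f]
    have "norm (f x * \<psi> x) \<le> norm (f x)" "norm (f x * (1 - \<psi> x)) \<le> norm (f x)" if "x \<in> space \<mu>" for x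
      using psi(2)[OF that] by (auto simp: abs_mult intro!: mult_left_le)
    then show "integrable \<mu> (\<lambda>x. f x * \<psi> x)" "integrable \<mu> (\<lambda>x. f x * (1 - \<psi> x))"
      by (intro Bochner_Integration.integrable_bound[OF f]; force)+
  qed
  have iF: "integrable \<mu> (F t)" if "t \<in> T" for t using F(1)[OF that] by (simp add: has_bochner_integral_iff)
  have iF0: "integrable \<mu> F0" using F0(1) by (simp add: has_bochner_integral_iff)
  have hG: "has_bochner_integral \<mu> G ((\<Sum>t\<in>T. 1) / N)" unfolding G_def
    by (intro has_bochner_integral_divide_zero has_bochner_integral_sum F(1))
  then have hG: "has_bochner_integral \<mu> G 1" using N by (simp add: N_def)
  then have iG: "integrable \<mu> G" by (simp add: has_bochner_integral_iff)
  have GG: "G x * G x / F0 x = (\<Sum>s\<in>T. \<Sum>t\<in>T. F s x * F t x / F0 x) / N\<^sup>2" for x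
    unfolding G_def by (simp add: sum_product[symmetric] sum_divide_distrib[symmetric] power2_eq_square)
  define J0 where "J0 = (\<Sum>s\<in>T. \<Sum>t\<in>T. J s t) / N\<^sup>2"
  have hGG: "has_bochner_integral \<mu> (\<lambda>x. G x * G x / F0 x) J0"
    unfolding GG J0_def by (intro has_bochner_integral_divide_zero has_bochner_integral_sum J)
  have J0: "J0 \<le> 1 + \<delta>\<^sup>2" using second_moment N by (simp add: J0_def N_def divide_le_eq)
  have hL: "has_bochner_integral \<mu> (\<lambda>x. (1 - \<delta> / 2 - 1 / (2 * \<delta>)) * F0 x + G x / \<delta> - (G x * G x / F0 x) / (2 * \<delta>))
      ((1 - \<delta> / 2 - 1 / (2 * \<delta>)) * 1 + 1 / \<delta> - J0 / (2 * \<delta>))"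
    by (intro has_bochner_integral_diff has_bochner_integral_add has_bochner_integral_divide_zero
        has_bochner_integral_mult_right F0 hG hGG)
  have "1 - \<delta> \<le> (1 - \<delta> / 2 - 1 / (2 * \<delta>)) * 1 + 1 / \<delta> - J0 / (2 * \<delta>)"
  proof -
    have "J0 / (2 * \<delta>) \<le> (1 + \<delta>\<^sup>2) / (2 * \<delta>)" using J0 d by (simp add: divide_right_mono)
    also have "\<dots> = 1 / (2 * \<delta>) + \<delta> / 2" using d by (simp add: add_divide_distrib power2_eq_square)
    finally have "J0 / (2 * \<delta>) \<le> 1 / (2 * \<delta>) + \<delta> / 2" .
    moreover have "1 / \<delta> = 2 * (1 / (2 * \<delta>))" using d by simp
    moreover have "K \<le> A + \<delta> / 2 \<Longrightarrow> B = 2 * A \<Longrightarrow> 1 - \<delta> \<le> (1 - \<delta> / 2 - A) * 1 + B - K" for A B K :: real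
      by simp
    ultimately show ?thesis by blast
  qed
  also have "\<dots> = (\<integral>x. (1 - \<delta> / 2 - 1 / (2 * \<delta>)) * F0 x + G x / \<delta> - (G x * G x / F0 x) / (2 * \<delta>) \<partial>\<mu>)"
    using hL by (simp add: has_bochner_integral_iff)
  also have "\<dots> \<le> (\<integral>x. F0 x * \<psi> x + G x * (1 - \<psi> x) \<partial>\<mu>)"
  proof (rule integral_mono)
    show "integrable \<mu> (\<lambda>x. (1 - \<delta> / 2 - 1 / (2 * \<delta>)) * F0 x + G x / \<delta> - (G x * G x / F0 x) / (2 * \<delta>))"
      using hL by (simp add: has_bochner_integral_iff)
    show "integrable \<mu> (\<lambda>x. F0 x * \<psi> x + G x * (1 - \<psi> x))"
      by (intro Bochner_Integration.integrable_add int_psi iF0 iG)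
    fix x assume "x \<in> space \<mu>"
    then show "(1 - \<delta> / 2 - 1 / (2 * \<delta>)) * F0 x + G x / \<delta> - (G x * G x / F0 x) / (2 * \<delta>) \<le> F0 x * \<psi> x + G x * (1 - \<psi> x)"
      using psi(2) F0(2) d by (intro affinity_pointwise_bound) auto
  qed
  also have "\<dots> = (\<integral>x. F0 x * \<psi> x \<partial>\<mu>) + (\<integral>x. G x * (1 - \<psi> x) \<partial>\<mu>)"
    by (intro Bochner_Integration.integral_add int_psi iF0 iG)
  also have "(\<integral>x. G x * (1 - \<psi> x) \<partial>\<mu>) = (\<Sum>t\<in>T. \<integral>x. F t x * (1 - \<psi> x) \<partial>\<mu>) / N"
  proof -
    have "(\<integral>x. G x * (1 - \<psi> x) \<partial>\<mu>) = (\<integral>x. (\<Sum>t\<in>T. F t x * (1 - \<psi> x)) / N \<partial>\<mu>)"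
      by (simp add: G_def sum_distrib_right)
    also have "\<dots> = (\<Sum>t\<in>T. \<integral>x. F t x * (1 - \<psi> x) \<partial>\<mu>) / N"
      using int_psi(2)[OF iF] by (simp add: Bochner_Integration.integral_sum)
    finally show ?thesis .
  qed
  finally have "N * (1 - \<delta>) \<le> (\<Sum>t\<in>T. (\<integral>x. F0 x * \<psi> x \<partial>\<mu>) + (\<integral>x. F t x * (1 - \<psi> x) \<partial>\<mu>))"
    using N by (simp add: sum.distrib N_def[symmetric] field_simps)
  also have "\<dots> < (\<Sum>t\<in>T. 1 - \<delta>)" by (rule sum_strict_mono[OF T less])
  finally show False by (simp add: N_def)
qed

section \<open>Random signed sums\<close>

text \<open>
  The function \<open>x\<^sup>2 / 2 - ln (cosh x)\<close> vanishes at \<open>0\<close> and has derivative \<open>x - tanh x\<close>.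
\<close>

lemma cosh_le_exp_half_square:
  fixes x :: real
  shows "cosh x \<le> exp (x\<^sup>2 / 2)"
proof -
  have main: "cosh x \<le> exp (x\<^sup>2 / 2)" if x: "x \<ge> 0" for x :: real
  proof -
    have tanh_le: "tanh y \<le> y" if y: "y \<ge> 0" for y :: real
    proof -
      have "(\<lambda>t. t - tanh t) 0 \<le> (\<lambda>t. t - tanh t) y"
        by (rule DERIV_nonneg_imp_nondecreasing[OF y])
          (auto intro!: exI[of _ "(tanh _)\<^sup>2"] derivative_eq_intros simp: cosh_real_nonzero)
      then show ?thesis by simp
    qed
    have "(\<lambda>t. t\<^sup>2 / 2 - ln (cosh t)) 0 \<le> (\<lambda>t. t\<^sup>2 / 2 - ln (cosh t)) x"
    proof (rule DERIV_nonneg_imp_nondecreasing[OF x])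
      fix t :: real assume "0 \<le> t" "t \<le> x"
      have "((\<lambda>t. t\<^sup>2 / 2 - ln (cosh t)) has_real_derivative (t - tanh t)) (at t)"
        by (auto intro!: derivative_eq_intros simp: tanh_def cosh_real_pos)
      then show "\<exists>y. ((\<lambda>t. t\<^sup>2 / 2 - ln (cosh t)) has_real_derivative y) (at t) \<and> 0 \<le> y"
        using tanh_le[OF \<open>0 \<le> t\<close>] by (intro exI[of _ "t - tanh t"]) simp
    qed
    then have "ln (cosh x) \<le> x\<^sup>2 / 2" by simp
    then show ?thesis using cosh_real_pos[of x] by (metis exp_le_cancel_iff exp_ln)
  qed
  show ?thesis using main[of "\<bar>x\<bar>"] by (cases "x \<ge> 0") (auto simp: cosh_minus)
qed

text \<open>
  A choice of signs is encoded by the set \<open>U\<close> of indices that carry a plus sign.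
\<close>

definition signed_sum :: "'a set \<Rightarrow> ('a \<Rightarrow> real) \<Rightarrow> 'a set \<Rightarrow> real" where
  "signed_sum I w U = (\<Sum>i\<in>I. if i \<in> U then w i else - w i)"

text \<open>
  The mean of \<open>exp (s X\<^sup>2)\<close> over random signs is at most its value \<open>(1 - 2 s \<sigma>\<^sup>2)\<^bsup>-1/2\<^esup>\<close> for a centred normal
  \<open>X\<close> with the same variance \<open>\<sigma>\<^sup>2\<close>.  Averaging over the sign of one summand \<open>w a\<close> produces a hyperbolic
  cosine; its Gaussian bound replaces \<open>s\<close> by the slightly larger \<open>s' = s (1 + y)\<close>, where
  \<open>y = 2 s (w a)\<^sup>2\<close>, at the price of a factor \<open>exp (y / 2)\<close>, and the claimed bound is stable under this
  step because \<open>exp y \<le> 1 / (1 - y)\<close> and \<open>1 + y \<le> 1 / (1 - y)\<close>.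
\<close>

proposition rademacher_square_exponential:
  assumes "finite I" and "s \<ge> 0" and "2 * s * (\<Sum>i\<in>I. (w i)\<^sup>2) < 1"
  shows "(\<Sum>U\<in>Pow I. exp (s * (signed_sum I w U)\<^sup>2)) \<le> 2 ^ card I / sqrt (1 - 2 * s * (\<Sum>i\<in>I. (w i)\<^sup>2))"
  using assms
proof (induction I arbitrary: s rule: finite_induct)
  case empty
  then show ?case by (simp add: signed_sum_def)
next
  case (insert a I)
  define W where "W = (\<Sum>i\<in>I. (w i)\<^sup>2)"
  define y where "y = 2 * s * (w a)\<^sup>2"
  define v where "v = 2 * s * W"
  define s' where "s' = s * (1 + y)"
  have W: "W \<ge> 0" by (simp add: W_def sum_nonneg)
  have y0: "y \<ge> 0" and v0: "v \<ge> 0" using insert.prems(1) W by (auto simp: y_def v_def)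
  have vy: "y + v < 1" using insert.prems(2) insert.hyps by (simp add: y_def v_def W_def distrib_left)
  have s'0: "s' \<ge> 0" using insert.prems(1) y0 by (simp add: s'_def)
  have s'W: "2 * s' * W = v * (1 + y)" by (simp add: s'_def v_def)
  have "v * (1 + y) \<le> (1 - y) * (1 + y)" using vy y0 by (intro mult_right_mono) auto
  \<comment> \<open>The square of the comparison below, after \<open>exp y\<close> has been replaced by \<open>1 / (1 - y)\<close>.\<close>
  have vb: "(1 - y - v) / (1 - y) \<le> 1 - v * (1 + y)"
  proof -
    have "0 \<le> v * (y * y)" using v0 y0 by simp
    then have "1 - y - v \<le> (1 - v * (1 + y)) * (1 - y)" by (simp add: algebra_simps)
    then show ?thesis using vy v0 by (simp add: pos_divide_le_eq)
  qed
  have pos: "0 < (1 - y - v) / (1 - y)" using vy v0 by simp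
  then have s'1: "2 * s' * W < 1" using vb s'W by linarith
  have pair: "exp (s * (w a + X)\<^sup>2) + exp (s * (- w a + X)\<^sup>2) \<le> 2 * exp (y / 2) * exp (s' * X\<^sup>2)" for X
  proof -
    have "exp (s * (w a + X)\<^sup>2) + exp (s * (- w a + X)\<^sup>2) = 2 * exp (s * (w a)\<^sup>2 + s * X\<^sup>2) * cosh (2 * s * w a * X)"
      by (simp add: cosh_field_def exp_add[symmetric] power2_eq_square algebra_simps)
    also have "\<dots> \<le> 2 * exp (s * (w a)\<^sup>2 + s * X\<^sup>2) * exp ((2 * s * w a * X)\<^sup>2 / 2)"
      by (intro mult_left_mono cosh_le_exp_half_square) simp
    also have "\<dots> = 2 * exp (y / 2) * exp (s' * X\<^sup>2)"
      by (simp add: exp_add[symmetric] y_def s'_def power2_eq_square algebra_simps)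
    finally show ?thesis .
  qed
  have Xsum: "signed_sum (insert a I) w U = - w a + signed_sum I w U"
    "signed_sum (insert a I) w (insert a U) = w a + signed_sum I w U" if "U \<in> Pow I" for U
  proof -
    have "a \<notin> U" using that insert.hyps by auto
    then show "signed_sum (insert a I) w U = - w a + signed_sum I w U"
      using insert.hyps by (simp add: signed_sum_def)
    have "(\<Sum>i\<in>I. if i \<in> insert a U then w i else - w i) = (\<Sum>i\<in>I. if i \<in> U then w i else - w i)"
      using insert.hyps by (intro sum.cong) auto
    then show "signed_sum (insert a I) w (insert a U) = w a + signed_sum I w U"
      using insert.hyps by (simp add: signed_sum_def)
  qed
  have inj: "inj_on (insert a) (Pow I)" using insert.hyps by (auto simp: inj_on_def)
  have "(\<Sum>U\<in>Pow (insert a I). exp (s * (signed_sum (insert a I) w U)\<^sup>2))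
      = (\<Sum>U\<in>Pow I. exp (s * (signed_sum (insert a I) w U)\<^sup>2)) + (\<Sum>U\<in>insert a ` Pow I. exp (s * (signed_sum (insert a I) w U)\<^sup>2))"
    unfolding Pow_insert using insert.hyps by (intro sum.union_disjoint) auto
  also have "(\<Sum>U\<in>insert a ` Pow I. exp (s * (signed_sum (insert a I) w U)\<^sup>2)) = (\<Sum>U\<in>Pow I. exp (s * (signed_sum (insert a I) w (insert a U))\<^sup>2))"
    by (simp add: sum.reindex[OF inj])
  also have "(\<Sum>U\<in>Pow I. exp (s * (signed_sum (insert a I) w U)\<^sup>2)) + (\<Sum>U\<in>Pow I. exp (s * (signed_sum (insert a I) w (insert a U))\<^sup>2))
      = (\<Sum>U\<in>Pow I. exp (s * (w a + signed_sum I w U)\<^sup>2) + exp (s * (- w a + signed_sum I w U)\<^sup>2))"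
    unfolding sum.distrib[symmetric] by (intro sum.cong refl) (simp add: Xsum)
  also have "\<dots> \<le> (\<Sum>U\<in>Pow I. 2 * exp (y / 2) * exp (s' * (signed_sum I w U)\<^sup>2))"
    by (intro sum_mono pair)
  also have "\<dots> = 2 * exp (y / 2) * (\<Sum>U\<in>Pow I. exp (s' * (signed_sum I w U)\<^sup>2))"
    by (simp add: sum_distrib_left)
  also have "\<dots> \<le> 2 * exp (y / 2) * (2 ^ card I / sqrt (1 - 2 * s' * W))"
    using insert.IH[OF s'0] s'1 unfolding W_def by (intro mult_left_mono) auto
  also have "\<dots> = 2 ^ card (insert a I) * (exp (y / 2) / sqrt (1 - v * (1 + y)))"
    using insert.hyps by (simp add: s'W)
  also have "\<dots> \<le> 2 ^ card (insert a I) * (1 / sqrt (1 - y - v))"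
  proof (rule mult_left_mono)
    have "1 - y \<le> exp (- y)" using exp_ge_add_one_self[of "- y"] by simp
    then have "exp y * (1 - y) \<le> 1" by (simp add: exp_minus field_simps)
    then have "exp y \<le> 1 / (1 - y)" using vy v0 by (simp add: pos_le_divide_eq)
    then have "exp y * (1 - y - v) \<le> (1 - y - v) / (1 - y)" using vy by (simp add: divide_inverse mult.commute mult_right_mono)
    also note vb
    finally have "sqrt (exp y * (1 - y - v)) \<le> sqrt (1 - v * (1 + y))" by simp
    moreover have "sqrt (exp y) = exp (y / 2)" 
      by (rule real_sqrt_unique) (simp_all add: power2_eq_square exp_add[symmetric])
    ultimately have "exp (y / 2) * sqrt (1 - y - v) \<le> sqrt (1 - v * (1 + y))" by (simp add: real_sqrt_mult)
    moreover have "sqrt (1 - y - v) > 0" "sqrt (1 - v * (1 + y)) > 0" using vy pos vb by auto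
    ultimately show "exp (y / 2) / sqrt (1 - v * (1 + y)) \<le> 1 / sqrt (1 - y - v)"
      by (simp add: field_simps)
  qed simp
  also have "1 - y - v = 1 - 2 * s * (\<Sum>i\<in>insert a I. (w i)\<^sup>2)"
    using insert.hyps by (simp add: y_def v_def W_def distrib_left)
  finally show ?case by simp
qed

section \<open>The sign mixture\<close>

definition sign_vec :: "nat \<Rightarrow> nat set \<Rightarrow> nat set \<Rightarrow> real vec" where
  "sign_vec d I U = vec d (\<lambda>i. if i \<in> I then (if i \<in> U then 1 else - 1) / sqrt (real (card I)) else 0)"

lemma sign_vec_carrier [simp]: "sign_vec d I U \<in> carrier_vec d"
  by (simp add: sign_vec_def)

lemma sum_restrict_to:
  fixes f :: "nat \<Rightarrow> real"
  assumes "I \<subseteq> {..<d}"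
  shows "(\<Sum>i<d. if i \<in> I then f i else 0) = (\<Sum>i\<in>I. f i)"
  using assms by (simp add: sum.If_cases Int_absorb1)

lemma sign_vec_scalar_prod:
  assumes I: "I \<subseteq> {..<d}" and w: "w \<in> carrier_vec d"
  shows "sign_vec d I U \<bullet> w = signed_sum I (($) w) U / sqrt (real (card I))"
proof -
  have "sign_vec d I U \<bullet> w = (\<Sum>i<d. if i \<in> I then (if i \<in> U then w $ i else - w $ i) / sqrt (real (card I)) else 0)"
    using w unfolding scalar_prod_def by (intro sum.cong) (auto simp: sign_vec_def)
  also have "\<dots> = signed_sum I (($) w) U / sqrt (real (card I))"
    unfolding sum_restrict_to[OF I] signed_sum_def sum_divide_distrib ..
  finally show ?thesis .
qed

lemma sign_vec_norm:
  assumes I: "I \<subseteq> {..<d}" "I \<noteq> {}"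
  shows "sign_vec d I U \<bullet> sign_vec d I U = 1"
proof -
  have fin: "finite I" using I(1) finite_subset by blast
  have c: "real (card I) > 0" using fin I(2) by (simp add: card_gt_0_iff)
  have "sign_vec d I U \<bullet> sign_vec d I U = (\<Sum>i<d. if i \<in> I then 1 / real (card I) else 0)"
    unfolding scalar_prod_def by (intro sum.cong) (auto simp: sign_vec_def)
  also have "\<dots> = 1" unfolding sum_restrict_to[OF I(1)] using c by simp
  finally show ?thesis .
qed

text \<open>
  The part \<open>z\<close> of \<open>y = C a\<close> outside \<open>I\<close> vanishes: \<open>S\<close> does not mix \<open>I\<close> with its complement, so
  \<open>qform S z = z \<bullet> (S y) = z \<bullet> a = 0\<close>.
\<close>

lemma inverse_block_orthogonal:
  assumes S: "pos_def d S" and C: "C \<in> carrier_mat d d" "S * C = 1\<^sub>m d"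
    and block: "\<And>i j. i < d \<Longrightarrow> j < d \<Longrightarrow> i \<notin> I \<Longrightarrow> j \<in> I \<Longrightarrow> S $$ (i, j) = 0"
    and a: "a \<in> carrier_vec d" "\<And>i. i < d \<Longrightarrow> i \<notin> I \<Longrightarrow> a $ i = 0"
    and b: "b \<in> carrier_vec d" "\<And>i. i < d \<Longrightarrow> i \<in> I \<Longrightarrow> b $ i = 0"
  shows "b \<bullet> (C *\<^sub>v a) = 0"
proof -
  have Sc: "S \<in> carrier_mat d d" using S by (simp add: pos_def_def)
  define y where "y = C *\<^sub>v a"
  have y: "y \<in> carrier_vec d" using C a by (simp add: y_def)
  have Sy: "S *\<^sub>v y = a" unfolding y_def using C Sc a by (metis assoc_mult_mat_vec one_mult_mat_vec)
  define z where "z = vec d (\<lambda>i. if i \<in> I then 0 else y $ i)"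
  have z: "z \<in> carrier_vec d" by (simp add: z_def)
  have rows: "(S *\<^sub>v z) $ i = (S *\<^sub>v y) $ i" if i: "i < d" "i \<notin> I" for i
  proof -
    have "row S i \<bullet> z = row S i \<bullet> y" unfolding scalar_prod_def
      using y Sc i block by (auto simp: z_def intro!: sum.cong)
    then show ?thesis using Sc i by simp
  qed
  have "qform S z = (\<Sum>i<d. z $ i * (S *\<^sub>v z) $ i)" using Sc by (simp add: scalar_prod_def atLeast0LessThan)
  also have "\<dots> = 0"
    using rows a(2) unfolding Sy by (intro sum.neutral) (auto simp: z_def)
  finally have "z = 0\<^sub>v d" using S z unfolding pos_def_def by (metis less_irrefl)
  then have "y $ i = 0" if "i < d" "i \<notin> I" for i
    using that index_vec[of i d "\<lambda>i. if i \<in> I then 0 else y $ i"] unfolding z_def by simp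
  then have "b $ i * y $ i = 0" if "i < d" for i using b(2) that by (cases "i \<in> I") auto
  then have "b \<bullet> y = 0" unfolding scalar_prod_def using y by (intro sum.neutral) auto
  then show ?thesis by (simp add: y_def)
qed

lemma inverse_mult_vec_bound:
  assumes S: "S \<in> carrier_mat d d" and C: "C \<in> carrier_mat d d" "S * C = 1\<^sub>m d"
    and lower: "\<And>x. x \<in> carrier_vec d \<Longrightarrow> 1 / K * (x \<bullet> x) \<le> qform S x" and K: "K > 0"
    and x: "x \<in> carrier_vec d"
  shows "(C *\<^sub>v x) \<bullet> (C *\<^sub>v x) \<le> K\<^sup>2 * (x \<bullet> x)"
proof -
  define y where "y = C *\<^sub>v x"
  have y: "y \<in> carrier_vec d" using C x by (simp add: y_def)
  have Sy: "S *\<^sub>v y = x" unfolding y_def using C S x by (metis assoc_mult_mat_vec one_mult_mat_vec)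
  have yy: "y \<bullet> y \<ge> 0" by (rule vec_norm_nonneg)
  have "y \<bullet> y \<le> K * (y \<bullet> x)" using lower[OF y] K unfolding Sy by (simp add: field_simps)
  then have "(y \<bullet> y)\<^sup>2 \<le> (K * (y \<bullet> x))\<^sup>2" using yy by (rule power_mono)
  also have "\<dots> \<le> K\<^sup>2 * ((y \<bullet> y) * (x \<bullet> x))"
    unfolding power_mult_distrib by (intro mult_left_mono vec_cauchy_schwarz[OF y x]) simp
  finally have "(y \<bullet> y) * (y \<bullet> y) \<le> (y \<bullet> y) * (K\<^sup>2 * (x \<bullet> x))" by (simp add: power2_eq_square mult_ac)
  then have "y \<bullet> y \<le> K\<^sup>2 * (x \<bullet> x)"
    using yy vec_norm_nonneg[of x] by (cases "y \<bullet> y = 0") auto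
  then show ?thesis by (simp add: y_def)
qed

lemma inverse_power_le_exp:
  fixes x :: real
  assumes "\<bar>x\<bar> \<le> 1 / 2"
  shows "(1 / (1 - x)) ^ n \<le> exp (2 * (real n * \<bar>x\<bar>))"
proof -
  have "2 * (\<bar>x\<bar> * \<bar>x\<bar>) \<le> \<bar>x\<bar>" using mult_right_mono[OF assms, of "\<bar>x\<bar>"] by simp
  then have "1 \<le> (1 + 2 * \<bar>x\<bar>) * (1 - \<bar>x\<bar>)" by (simp add: algebra_simps)
  also have "\<dots> \<le> (1 + 2 * \<bar>x\<bar>) * (1 - x)" by (intro mult_left_mono) auto
  finally have "1 / (1 - x) \<le> 1 + 2 * \<bar>x\<bar>" using assms by (simp add: pos_divide_le_eq)
  also have "\<dots> \<le> exp (2 * \<bar>x\<bar>)" by (rule exp_ge_add_one_self)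
  finally have "(1 / (1 - x)) ^ n \<le> exp (2 * \<bar>x\<bar>) ^ n" using assms by (intro power_mono) auto
  then show ?thesis by (simp add: exp_of_nat_mult[symmetric] mult_ac)
qed

lemma sign_vec_square_exponential:
  assumes I: "I \<subseteq> {..<d}" "I \<noteq> {}" and w: "w \<in> carrier_vec d" and ww: "w \<bullet> w \<le> K"
    and z: "\<zeta> \<ge> 0" "2 * \<zeta> * K < 1"
  shows "(\<Sum>U\<in>Pow I. exp (\<zeta> * (real (card I) * (sign_vec d I U \<bullet> w)\<^sup>2))) \<le> 2 ^ card I / sqrt (1 - 2 * \<zeta> * K)"
proof -
  have fin: "finite I" using I(1) finite_subset by blast
  have c: "real (card I) > 0" using fin I(2) by (simp add: card_gt_0_iff)
  have "(\<Sum>i\<in>I. (w $ i)\<^sup>2) \<le> (\<Sum>i<d. (w $ i)\<^sup>2)" using I by (intro sum_mono2) auto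
  also have "\<dots> = w \<bullet> w" using w by (simp add: scalar_prod_def power2_eq_square atLeast0LessThan)
  finally have wK: "(\<Sum>i\<in>I. (w $ i)\<^sup>2) \<le> K" using ww by simp
  then have le: "2 * \<zeta> * (\<Sum>i\<in>I. (w $ i)\<^sup>2) \<le> 2 * \<zeta> * K" using z by (intro mult_left_mono) auto
  have "(\<Sum>U\<in>Pow I. exp (\<zeta> * (real (card I) * (sign_vec d I U \<bullet> w)\<^sup>2))) = (\<Sum>U\<in>Pow I. exp (\<zeta> * (signed_sum I (($) w) U)\<^sup>2))"
    using c by (intro sum.cong refl) (simp add: sign_vec_scalar_prod[OF I(1) w] power_divide)
  also have "\<dots> \<le> 2 ^ card I / sqrt (1 - 2 * \<zeta> * (\<Sum>i\<in>I. (w $ i)\<^sup>2))"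
    using le z by (intro rademacher_square_exponential fin) auto
  also have "\<dots> \<le> 2 ^ card I / sqrt (1 - 2 * \<zeta> * K)"
    using le z by (intro divide_left_mono) auto
  finally show ?thesis .
qed

text \<open>
  Here \<open>\<kappa>\<close> is half of the distance between \<open>1/M\<close> and \<open>1/M0\<close>; it bounds the perturbation strength \<open>r\<close>,
  and \<open>\<zeta> \<le> \<delta>\<^sup>2 / (4 M0\<^sup>2)\<close> bounds the second moment of the mixture.  A pair \<open>(U, V)\<close> of sets of positive
  signs indexes the alternatives.
\<close>

proposition testing_lower_bound:
  fixes p q n :: nat and SX SY :: "real mat" and M M0 \<delta> \<zeta> \<kappa> :: real
  assumes M: "1 \<le> M0" "M0 < M" and d: "0 < \<delta>" "\<delta> < 1"
    and \<kappa>: "\<kappa> = (1 / M0 - 1 / M) / 2"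
    and \<zeta>: "0 < \<zeta>" "\<zeta> * M \<le> \<kappa>\<^sup>2" "\<zeta> \<le> \<delta>\<^sup>2 / (4 * M0\<^sup>2)"
    and pqn: "p \<ge> 1" "q \<ge> 1" "n \<ge> 1" and ratio: "sqrt (real p * real q) / real n \<le> M"
    and cov: "covariance_mat p SX" "covariance_mat q SY"
    and spec: "1 / M0 \<le> lambda_min (block_diag SX SY)" "lambda_max (block_diag SX SY) \<le> M0"
    and psi: "\<psi> \<in> tests n (p + q)"
  shows "\<exists>S \<in> Theta p q n \<zeta> SX SY M. 1 - \<delta> \<le> testing_risk n (p + q) (block_diag SX SY) S \<psi>"
proof -
  define D where "D = p + q"
  define S0 where "S0 = block_diag SX SY"
  have SX: "SX \<in> carrier_mat p p" "transpose_mat SX = SX" and SY: "SY \<in> carrier_mat q q" "transpose_mat SY = SY"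
    using cov by (auto simp: covariance_mat_def)
  have S0c: "S0 \<in> carrier_mat D D" using SX SY by (auto simp: S0_def block_diag_def D_def)
  have S0e: "S0 $$ (i, j) = (if i < p then (if j < p then SX $$ (i, j) else 0)
      else (if j < p then 0 else SY $$ (i - p, j - p)))" if "i < D" "j < D" for i j
    using that SX SY by (auto simp: S0_def block_diag_def D_def)
  have S0t: "transpose_mat S0 = S0"
    by (rule eq_matI) (use S0c in \<open>auto simp: S0e D_def symmetric_index[OF SX] symmetric_index[OF SY]\<close>)
  have D1: "D \<ge> 1" using pqn by (simp add: D_def)
  have lower: "1 / M0 * (x \<bullet> x) \<le> qform S0 x" if "x \<in> carrier_vec D" for x
    using spec(1) that lambda_min_ge_iff[OF S0c S0t D1] by (simp add: S0_def)
  have upper: "qform S0 x \<le> M0 * (x \<bullet> x)" if "x \<in> carrier_vec D" for x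
    using spec(2) that lambda_max_le_iff[OF S0c S0t D1] by (simp add: S0_def)
  define I where "I = {..<p}"
  define J where "J = {p..<D}"
  have I: "I \<subseteq> {..<D}" "I \<noteq> {}" "card I = p" using pqn by (auto simp: I_def D_def lessThan_empty_iff)
  have J: "J \<subseteq> {..<D}" "J \<noteq> {}" "card J = q" using pqn by (auto simp: J_def D_def)
  define r where "r = sqrt (\<zeta> * sqrt (real p * real q) / real n)"
  have r2: "r\<^sup>2 = \<zeta> * sqrt (real p * real q) / real n" using \<zeta>(1) by (simp add: r_def)
  have r0: "r \<ge> 0" using \<zeta>(1) by (simp add: r_def)
  have M1: "M0 > 0" "M > 0" "M0 * M \<ge> 1" using M mult_mono[of 1 M0 1 M] by auto
  have \<kappa>0: "\<kappa> > 0" unfolding \<kappa> using M by (simp add: frac_less2)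
  have "r\<^sup>2 \<le> \<zeta> * M" using mult_left_mono[OF ratio, of \<zeta>] \<zeta>(1) by (simp add: r2)
  then have "r\<^sup>2 \<le> \<kappa>\<^sup>2" using \<zeta>(2) by linarith
  then have r\<kappa>: "r \<le> \<kappa>" by (rule power2_le_imp_le) (use \<kappa>0 in simp)
  \<comment> \<open>The perturbation changes the quadratic form on unit vectors by at most \<open>2 r\<close>.\<close>
  have r_lower: "2 * r \<le> 1 / M0 - 1 / M" using r\<kappa> \<kappa> by simp
  have r_small: "2 * r < 1 / M0" 
  proof -
    have "1 / M > 0" using M1 by simp
    then show ?thesis using r_lower by linarith
  qed
  \<comment> \<open>The room above \<open>M0\<close> is at least the room below \<open>1 / M0\<close>, since \<open>M0 M \<ge> 1\<close>.\<close>
  have r_upper: "M0 + 2 * r \<le> M"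
  proof -
    have "1 / M0 - 1 / M = (M - M0) / (M0 * M)" using M1 by (simp add: field_simps)
    also have "\<dots> \<le> (M - M0) / 1" using M M1 by (intro divide_left_mono) auto
    finally show ?thesis using r_lower by simp
  qed
  have rM0: "r\<^sup>2 * M0\<^sup>2 \<le> 1 / 2"
  proof -
    have "2 * r * M0 \<le> 1" using r_small M1 by (simp add: field_simps)
    then have "(2 * r * M0)\<^sup>2 \<le> 1" using r0 M1 by (simp add: power_le_one)
    then show ?thesis by (simp add: power_mult_distrib)
  qed
  have p0: "pos_def D S0" unfolding pos_def_def
    using S0c S0t lower vec_norm_pos M1 by (meson less_le_trans mult_pos_pos zero_less_divide_1_iff)
  obtain C0 where C0: "mat_inverse S0 = Some C0" "pos_def D C0" "S0 * C0 = 1\<^sub>m D" using pos_def_invertible[OF p0] by metis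
  have C0c: "C0 \<in> carrier_mat D D" "transpose_mat C0 = C0" using C0 by (auto simp: pos_def_def)
  define a where "a U = sign_vec D I U" for U
  define b where "b V = sign_vec D J V" for V
  have a: "a U \<in> carrier_vec D" "a U \<bullet> a U = 1" for U
    unfolding a_def using sign_vec_norm[OF I(1,2)] by auto
  have b: "b V \<in> carrier_vec D" "b V \<bullet> b V = 1" for V
    unfolding b_def using sign_vec_norm[OF J(1,2)] by auto
  have b_orth: "b V \<bullet> (C0 *\<^sub>v a U) = 0" for U V
  proof (rule inverse_block_orthogonal[where I = I, OF p0 C0c(1) C0(3)])
    show "S0 $$ (i, j) = 0" if "i < D" "j < D" "i \<notin> I" "j \<in> I" for i j
      using that by (auto simp: S0e I_def)
    show "a U $ i = 0" if "i < D" "i \<notin> I" for i using that by (simp add: a_def sign_vec_def)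
    show "b V $ i = 0" if "i < D" "i \<in> I" for i using that by (simp add: b_def sign_vec_def I_def J_def)
  qed (use a b in auto)
  have a_orth: "a U \<bullet> (C0 *\<^sub>v b V) = 0" for U V
    using b_orth symmetric_bilinear[OF C0c b(1) a(1)] by metis
  \<comment> \<open>This makes the coefficients of the signed sums \<open>\<surd>p \<alpha>\<close> and \<open>\<surd>q \<beta>\<close> bounded in square sum.\<close>
  have C0_bound: "(C0 *\<^sub>v x) \<bullet> (C0 *\<^sub>v x) \<le> M0\<^sup>2" if "x \<in> carrier_vec D" "x \<bullet> x = 1" for x
    using inverse_mult_vec_bound[OF S0c C0c(1) C0(3) lower M1(1) that(1)] that(2) by simp
  define \<alpha> where "\<alpha> U' U = a U \<bullet> (C0 *\<^sub>v a U')" for U' U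
  define \<beta> where "\<beta> V' V = b V \<bullet> (C0 *\<^sub>v b V')" for V' V
  have bound: "\<bar>x \<bullet> (C0 *\<^sub>v y)\<bar> \<le> M0" if "x \<in> carrier_vec D" "x \<bullet> x = 1" "y \<in> carrier_vec D" "y \<bullet> y = 1" for x y
  proof -
    have "(x \<bullet> (C0 *\<^sub>v y))\<^sup>2 \<le> M0\<^sup>2"
      using vec_cauchy_schwarz[of x D "C0 *\<^sub>v y"] C0_bound[OF that(3,4)] C0c that by simp
    then show ?thesis using M1 by (simp add: abs_le_square_iff[symmetric])
  qed
  have \<alpha>\<beta>: "\<bar>r\<^sup>2 * \<alpha> U' U * \<beta> V' V\<bar> \<le> 1 / 2" for U' U V' V
  proof -
    have "\<bar>r\<^sup>2 * \<alpha> U' U * \<beta> V' V\<bar> = r\<^sup>2 * (\<bar>\<alpha> U' U\<bar> * \<bar>\<beta> V' V\<bar>)" by (simp add: abs_mult)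
    also have "\<dots> \<le> r\<^sup>2 * (M0 * M0)"
      unfolding \<alpha>_def \<beta>_def using M1 by (intro mult_left_mono mult_mono bound a b) auto
    finally show ?thesis using rM0 by (simp add: power2_eq_square)
  qed
  define S where "S t = spiked D S0 r (a (fst t)) (b (snd t))" for t
  have pS: "pos_def D (S t)" for t unfolding S_def by (rule pos_def_spiked[OF S0c S0t lower a b r0 r_small])
  define T where "T = Pow I \<times> Pow J"
  have T: "finite T" "T \<noteq> {}" "card T = 2 ^ p * 2 ^ q"
    unfolding T_def using I J finite_subset[OF I(1)] finite_subset[OF J(1)] by (auto simp: card_cartesian_product card_Pow)
  have S_Theta: "S t \<in> Theta p q n \<zeta> SX SY M" for t
  proof -
    define SXY where "SXY = mat p q (\<lambda>(i, j). r * (a (fst t) $ i * b (snd t) $ (p + j)))"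
    have SXYc: "SXY \<in> carrier_mat p q" by (simp add: SXY_def)
    have ae: "a (fst t) $ i = 0" if "i < D" "\<not> i < p" for i using that by (simp add: a_def sign_vec_def I_def)
    have be: "b (snd t) $ i = 0" if "i < p" for i using that by (simp add: b_def sign_vec_def J_def D_def)
    have blk: "four_block_mat SX SXY (transpose_mat SXY) SY = S t"
      by (rule eq_matI) (use SX SY in \<open>auto simp: S_def spiked_def SXY_def S0e ae be D_def\<close>)
    have a2: "(a (fst t) $ i)\<^sup>2 = 1 / real p" if "i < p" for i
      using that I(3) pqn by (simp add: a_def sign_vec_def I_def D_def power_divide)
    have b2: "(b (snd t) $ (p + j))\<^sup>2 = 1 / real q" if "j < q" for j
      using that J(3) pqn by (simp add: b_def sign_vec_def J_def D_def power_divide)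
    have "(frobenius_norm SXY)\<^sup>2 = (\<Sum>i<p. \<Sum>j<q. (SXY $$ (i, j))\<^sup>2)"
      unfolding frobenius_norm_def using SXYc by (simp add: sum_nonneg)
    also have "\<dots> = (\<Sum>i<p. \<Sum>j<q. r\<^sup>2 * (1 / real p * (1 / real q)))"
      by (intro sum.cong refl) (simp add: SXY_def power_mult_distrib a2 b2)
    also have "\<dots> = r\<^sup>2" using pqn by simp
    finally have frob: "(frobenius_norm SXY)\<^sup>2 \<ge> \<zeta> * sqrt (real p * real q) / real n" by (simp add: r2)
    have St: "S t \<in> carrier_mat D D" "transpose_mat (S t) = S t" using pS[of t] by (auto simp: pos_def_def)
    have dev: "\<bar>qform (S t) x - qform S0 x\<bar> \<le> 2 * r * (x \<bullet> x)" if "x \<in> carrier_vec D" for x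
      unfolding S_def by (rule qform_spiked_bound[OF S0c a b that r0])
    have lo: "1 / M * (x \<bullet> x) \<le> qform (S t) x" if x: "x \<in> carrier_vec D" for x
    proof -
      have "(2 * r + 1 / M) * (x \<bullet> x) \<le> 1 / M0 * (x \<bullet> x)" using r_lower vec_norm_nonneg by (intro mult_right_mono) auto
      then show ?thesis using dev[OF x] lower[OF x] by (simp add: distrib_right)
    qed
    have hi: "qform (S t) x \<le> M * (x \<bullet> x)" if x: "x \<in> carrier_vec D" for x
    proof -
      have "(M0 + 2 * r) * (x \<bullet> x) \<le> M * (x \<bullet> x)" using r_upper vec_norm_nonneg by (intro mult_right_mono) auto
      then show ?thesis using dev[OF x] upper[OF x] by (simp add: distrib_right)
    qed
    have "covariance_mat D (S t)" unfolding covariance_mat_def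
      using St lo M1 vec_norm_nonneg by (meson divide_nonneg_pos mult_nonneg_nonneg order_trans zero_le_one)
    moreover have "1 / M \<le> lambda_min (S t)" using lo lambda_min_ge_iff[OF St D1] by blast
    moreover have "lambda_max (S t) \<le> M" using hi lambda_max_le_iff[OF St D1] by blast
    ultimately show ?thesis unfolding Theta_def using SXYc frob blk
      by (intro CollectI exI[of _ SXY]) (simp add: D_def)
  qed
  \<comment> \<open>The contribution of the pair \<open>(s, t)\<close> to the second moment of the mixture.\<close>
  define E where "E s t = (1 / (1 - r\<^sup>2 * \<alpha> (fst s) (fst t) * \<beta> (snd s) (snd t))) ^ n" for s t
  have cross: "has_bochner_integral (samples n D)
      (\<lambda>\<omega>. likelihood n D (S s) \<omega> * likelihood n D (S t) \<omega> / likelihood n D S0 \<omega>) (E s t)" for s t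
    unfolding E_def
  proof (rule has_bochner_integral_likelihood_cross[OF p0 pS pS])
    have fold: "a (fst s) \<bullet> (C0 *\<^sub>v a (fst t)) = \<alpha> (fst s) (fst t)" "b (snd s) \<bullet> (C0 *\<^sub>v b (snd t)) = \<beta> (snd s) (snd t)"
      unfolding \<alpha>_def \<beta>_def using symmetric_bilinear[OF C0c] a b by auto
    have small: "r\<^sup>2 * (a (fst s) \<bullet> (C0 *\<^sub>v a (fst t))) * (b (snd s) \<bullet> (C0 *\<^sub>v b (snd t))) < 1"
      using \<alpha>\<beta>[of "fst s" "fst t" "snd s" "snd t"] unfolding fold by linarith
    show "(\<integral>\<^sup>+ x. ennreal (mvn_density D (S s) x * mvn_density D (S t) x / mvn_density D S0 x) \<partial>euclid D)
        = ennreal (1 / (1 - r\<^sup>2 * \<alpha> (fst s) (fst t) * \<beta> (snd s) (snd t)))"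
      unfolding S_def fold[symmetric]
      by (rule spiked_cross_moment[OF S0c S0t lower a b a b r0 r_small C0(1) b_orth a_orth small])
    show "0 \<le> 1 / (1 - r\<^sup>2 * \<alpha> (fst s) (fst t) * \<beta> (snd s) (snd t))"
      using \<alpha>\<beta>[of "fst s" "fst t" "snd s" "snd t"] by simp
  qed
  define \<tau> where "\<tau> = 2 * \<zeta> * M0\<^sup>2"
  have \<tau>: "\<tau> \<le> \<delta>\<^sup>2 / 2" using \<zeta>(3) M1 by (simp add: \<tau>_def field_simps)
  have "\<delta>\<^sup>2 < 1" using d by (simp add: power_less_one_iff)
  then have \<tau>1: "0 \<le> \<tau>" "\<tau> \<le> 1 / 2" using \<tau> \<zeta>(1) by (auto simp: \<tau>_def)
  \<comment> \<open>For a fixed first pair of sign vectors the average over the second one factorises.\<close>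
  have row_sum: "(\<Sum>t\<in>T. E s t) \<le> 2 ^ p * 2 ^ q * (1 + \<delta>\<^sup>2)" for s
  proof -
    define x where "x U = sign_vec D I U \<bullet> (C0 *\<^sub>v a (fst s))" for U
    define y where "y V = sign_vec D J V \<bullet> (C0 *\<^sub>v b (snd s))" for V
    have E_le: "E s (U, V) \<le> exp (\<zeta> * (real (card I) * (x U)\<^sup>2)) * exp (\<zeta> * (real (card J) * (y V)\<^sup>2))" for U V
    proof -
      have "E s (U, V) \<le> exp (2 * (real n * \<bar>r\<^sup>2 * \<alpha> (fst s) U * \<beta> (snd s) V\<bar>))"
        unfolding E_def by (simp only: fst_conv snd_conv) (rule inverse_power_le_exp[OF \<alpha>\<beta>])
      also have "real n * \<bar>r\<^sup>2 * \<alpha> (fst s) U * \<beta> (snd s) V\<bar> = \<zeta> * ((sqrt p * \<bar>x U\<bar>) * (sqrt q * \<bar>y V\<bar>))"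
        using pqn \<zeta>(1) unfolding r2 by (simp add: abs_mult x_def y_def \<alpha>_def \<beta>_def a_def b_def real_sqrt_mult)
      also have "2 * (\<zeta> * ((sqrt p * \<bar>x U\<bar>) * (sqrt q * \<bar>y V\<bar>))) \<le> \<zeta> * ((sqrt p * \<bar>x U\<bar>)\<^sup>2 + (sqrt q * \<bar>y V\<bar>)\<^sup>2)"
        using sum_squares_bound[of "sqrt p * \<bar>x U\<bar>" "sqrt q * \<bar>y V\<bar>"] \<zeta>(1) by simp
      finally show ?thesis by (simp add: I(3) J(3) power_mult_distrib distrib_left exp_add)
    qed
    have "(\<Sum>t\<in>T. E s t) = (\<Sum>U\<in>Pow I. \<Sum>V\<in>Pow J. E s (U, V))"
      unfolding T_def by (simp add: sum.cartesian_product)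
    also have "\<dots> \<le> (\<Sum>U\<in>Pow I. \<Sum>V\<in>Pow J. exp (\<zeta> * (real (card I) * (x U)\<^sup>2)) * exp (\<zeta> * (real (card J) * (y V)\<^sup>2)))"
      by (intro sum_mono E_le)
    also have "\<dots> = (\<Sum>U\<in>Pow I. exp (\<zeta> * (real (card I) * (x U)\<^sup>2))) * (\<Sum>V\<in>Pow J. exp (\<zeta> * (real (card J) * (y V)\<^sup>2)))"
      by (simp only: sum_product)
    also have "\<dots> \<le> (2 ^ p / sqrt (1 - \<tau>)) * (2 ^ q / sqrt (1 - \<tau>))"
    proof (rule mult_mono)
      show "(\<Sum>U\<in>Pow I. exp (\<zeta> * (real (card I) * (x U)\<^sup>2))) \<le> 2 ^ p / sqrt (1 - \<tau>)"
        unfolding x_def \<tau>_def I(3)[symmetric] using a C0c \<zeta>(1) \<tau>1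
        by (intro sign_vec_square_exponential I C0_bound) (auto simp: \<tau>_def)
      show "(\<Sum>V\<in>Pow J. exp (\<zeta> * (real (card J) * (y V)\<^sup>2))) \<le> 2 ^ q / sqrt (1 - \<tau>)"
        unfolding y_def \<tau>_def J(3)[symmetric] using b C0c \<zeta>(1) \<tau>1
        by (intro sign_vec_square_exponential J C0_bound) (auto simp: \<tau>_def)
    qed (use \<tau>1 in \<open>auto intro: sum_nonneg\<close>)
    also have "\<dots> = 2 ^ p * 2 ^ q * (1 / (1 - \<tau>))" using \<tau>1 by simp
    also have "\<dots> \<le> 2 ^ p * 2 ^ q * (1 + \<delta>\<^sup>2)"
    proof (rule mult_left_mono)
      have "2 * (\<tau> * \<tau>) \<le> \<tau>" using mult_right_mono[OF \<tau>1(2) \<tau>1(1)] by simp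
      then have "1 \<le> (1 + 2 * \<tau>) * (1 - \<tau>)" by (simp add: algebra_simps)
      then have "1 / (1 - \<tau>) \<le> 1 + 2 * \<tau>" using \<tau>1 by (simp add: pos_divide_le_eq)
      then show "1 / (1 - \<tau>) \<le> 1 + \<delta>\<^sup>2" using \<tau> by linarith
    qed simp
    finally show ?thesis .
  qed
  have second_moment: "(\<Sum>s\<in>T. \<Sum>t\<in>T. E s t) \<le> (1 + \<delta>\<^sup>2) * (real (card T))\<^sup>2"
  proof -
    have "(\<Sum>s\<in>T. \<Sum>t\<in>T. E s t) \<le> (\<Sum>s\<in>T. 2 ^ p * 2 ^ q * (1 + \<delta>\<^sup>2))" by (intro sum_mono row_sum)
    also have "\<dots> = (1 + \<delta>\<^sup>2) * (real (card T))\<^sup>2" by (simp add: T(3) power2_eq_square)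
    finally show ?thesis .
  qed
  note psiD = psi[folded D_def]
  obtain t where "t \<in> T" "1 - \<delta> \<le> (\<integral>\<omega>. likelihood n D S0 \<omega> * \<psi> \<omega> \<partial>samples n D)
      + (\<integral>\<omega>. likelihood n D (S t) \<omega> * (1 - \<psi> \<omega>) \<partial>samples n D)"
    using second_moment_testing_bound[where F = "\<lambda>t. likelihood n D (S t)", OF T(1,2) d(1)
        has_bochner_integral_likelihood[OF p0] likelihood_pos[OF p0]
        has_bochner_integral_likelihood[OF pS] less_imp_le[OF likelihood_pos[OF pS]] cross second_moment
        tests_measurable[OF psiD]] by blast
  then have "1 - \<delta> \<le> testing_risk n D S0 (S t) \<psi>" by (simp add: testing_risk_eq[OF p0 pS psiD])
  then show ?thesis using S_Theta unfolding D_def S0_def by blast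
qed

theorem theorem3p3:
  fixes M M0 \<delta> :: real
  assumes "M > 1" and "1 \<le> M0" and "M0 < M" and "0 < \<delta>" and "\<delta> < 1"
  shows "\<exists>\<zeta>>0. \<forall>(p::nat) (q::nat) (n::nat) SX SY.
           p \<ge> 1 \<longrightarrow> q \<ge> 1 \<longrightarrow> n \<ge> 1 \<longrightarrow>
           sqrt (real p * real q) / real n \<le> M \<longrightarrow>
           covariance_mat p SX \<longrightarrow> covariance_mat q SY \<longrightarrow>
           1 / M0 \<le> lambda_min (block_diag SX SY) \<longrightarrow> lambda_max (block_diag SX SY) \<le> M0 \<longrightarrow>
           (INF \<psi> \<in> tests n (p + q). SUP S \<in> Theta p q n \<zeta> SX SY M.
              ereal (testing_risk n (p + q) (block_diag SX SY) S \<psi>)) \<ge> ereal (1 - \<delta>)"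
proof -
  \<comment> \<open>The first bound on \<open>\<zeta>\<close> keeps the alternatives within the spectral limits, the second one
    makes the second moment of the mixture at most \<open>1 + \<delta>\<^sup>2\<close>.\<close>
  define \<kappa> where "\<kappa> = (1 / M0 - 1 / M) / 2"
  define \<zeta> where "\<zeta> = min (\<kappa>\<^sup>2 / M) (\<delta>\<^sup>2 / (4 * M0\<^sup>2))"
  have "\<kappa> > 0" unfolding \<kappa>_def using assms by (simp add: frac_less2)
  then have z: "0 < \<zeta>" "\<zeta> \<le> \<delta>\<^sup>2 / (4 * M0\<^sup>2)" using assms by (auto simp: \<zeta>_def)
  have "\<zeta> \<le> \<kappa>\<^sup>2 / M" by (simp add: \<zeta>_def)
  then have zM: "\<zeta> * M \<le> \<kappa>\<^sup>2" using assms by (simp add: pos_le_divide_eq)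
  show ?thesis
  proof (intro exI[of _ \<zeta>] conjI z(1) allI impI INF_greatest)
    fix p q n :: nat and SX SY :: "real mat" and \<psi>
    assume "p \<ge> 1" "q \<ge> 1" "n \<ge> 1" "sqrt (real p * real q) / real n \<le> M"
      "covariance_mat p SX" "covariance_mat q SY"
      "1 / M0 \<le> lambda_min (block_diag SX SY)" "lambda_max (block_diag SX SY) \<le> M0"
      "\<psi> \<in> tests n (p + q)"
    then obtain S where "S \<in> Theta p q n \<zeta> SX SY M" "1 - \<delta> \<le> testing_risk n (p + q) (block_diag SX SY) S \<psi>"
      using testing_lower_bound[OF assms(2-5) \<kappa>_def z(1) zM z(2)] by blast
    then show "ereal (1 - \<delta>) \<le> (SUP S \<in> Theta p q n \<zeta> SX SY M. ereal (testing_risk n (p + q) (block_diag SX SY) S \<psi>))"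
      by (intro SUP_upper2[of S]) auto
  qed
qed

end
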